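(* Let $\mathbf{t}=\langle T_*,b_*,\langle\|\cdot\|_t: t\in T_*\rangle\rangle$ be a tree-creature frame satisfying $\lim_{n\to\infty}\min_{t\in\mathrm{Lev}_n(T_* )}\log_n b_*(t)=\infty$, and let $\tilde{\mathbb{E}}=\tilde{\mathbb{E}}_{\mathbf{t}}$. Let $\Xi\colon\mathcal{P}(K)\to[0,1]$ be a fam with the uap and $\bar I=\langle I_k:k\in K\rangle$ a partition of a set $W$ into finite sets. Then for every $s\in T_*\setminus\{\langle\ \rangle\}$ there is a function $\lim^{\Xi,\bar I}\colon (E'_s)^W\to\tilde{\mathbb{E}}$ such that $\lim^{\Xi,\bar I}\bar r$ has stem $s$ for every $\bar r\in(E'_s)^W$, and such that the following holds: for any $i^*<\omega$, any $s_i\in T_*\setminus\{\langle\ \rangle\}$ and $\bar r^i=\langle r^i_\ell:\ell\in W\rangle\in(E'_{s_i})^W$ for $i<i^*$, any finite partition $P$ of $K$, any $\varepsilon'>0$, and any $q\in\tilde{\mathbb{E}}$ with $q\le \lim^{\Xi,\bar I}\bar r^i$ for all $i<i^*$, there are $q'\le q$ in $\tilde{\mathbb{E}}$ and a finite non-empty $u\subseteq K$ such that (1) $\left|\frac{|u\cap B|}{|u|}-\Xi(B)\right|<\varepsilon'$ for all $B\in P$, and (2) $\displaystyle\frac{1}{|u|}\sum_{k\in u}\frac{|\{\ell\in I_k: q'\le r^i_\ell\}|}{|I_k|}>1-\frac{2}{|s_i|}-\varepsilon'$ for all $i<i^*$.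
   Context: A norm of subsets of a set $C$ is a map $\|\cdot\|\colon\mathcal{P}(C)\to[0,\infty]$ with $\|A\|\le\|B\|$ whenever $A\subseteq B\subseteq C$, and $\|\emptyset\|=0$. For an integer $m>1$, such a norm is $m$-co-big if for every finite set $I$, every sequence $\langle A_i: i\in I\rangle$ of subsets of $C$, every $g\colon I\to[0,1]$ with $\sum_{i\in I}g(i)=1$ and every real $\varepsilon>0$, the set $B=\{k\in C: \sum\{g(i): i\in I,\ k\in A_i\}>1-\varepsilon\}$ satisfies $\|B\|\ge \min_{i\in I}\|A_i\|-\log_m(1/\varepsilon)$. For a tree $T$ and $t\in T$, $\mathrm{suc}_T(t)$ is the set of immediate successors of $t$, and $\mathrm{Lev}_n(T)$ the set of nodes of height $n$. A tree-creature frame is a triple $\mathbf{t}=\langle T_*,b_*,\langle\|\cdot\|_t: t\in T_*\rangle\rangle$ where: $T_*\subseteq\omega^{<\omega}$ is a finitely branching tree (closed under initial segments) of height $\omega$ with single root $\langle\ \rangle$ and no maximal nodes; $b_*\colon T_*\to\omega$ satisfies $\lim_{n}\min_{t\in\mathrm{Lev}_n(T_* )}b_*(t)=\infty$; and for each $t$, $\|\cdot\|_t$ is a $b_*(t)$-co-big norm of subsets of $\mathrm{suc}_{T_*}(t)$ in which all singletons have norm $<1$ and $\|\mathrm{suc}_{T_*}(t)\|_t=\infty$. For a subtree $p\subseteq T_*$, $\mathrm{stem}(p)$ is the node $s\in p$ of least length with $|\mathrm{suc}_p(s)|\ge2$; $|s|$ is the length of $s$. $\tilde{\mathbb{E}}_{\mathbf{t}}$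 consists of all subtrees $p\subseteq T_*$ (nonempty, closed under initial segments) whose stem exists and with $\|p\|_t:=\|\mathrm{suc}_p(t)\|_t\ge 1+\frac{1}{|\mathrm{stem}(p)|}$ for every $t\in p$ extending $\mathrm{stem}(p)$ (convention $\frac10=\infty$), ordered by inclusion. For $s\in T_*\setminus\{\langle\ \rangle\}$, \[E'_s=\left\{p\in\tilde{\mathbb{E}}: \mathrm{stem}(p)=s\text{ and }\|p\|_t\ge 1+\tfrac{1}{|s|}+4\log_{b_*(t)}|t|\text{ for all }t\in p\text{ extending }s\right\}.\] A (probability) fam on $\mathcal{P}(K)$ is $\Xi\colon\mathcal{P}(K)\to[0,1]$ with $\Xi(\emptyset)=0$, $\Xi(K)=1$ and $\Xi(a\cup b)=\Xi(a)+\Xi(b)$ for disjoint $a,b$. It has the uniform approximation property (uap) if for every $\varepsilon>0$ and every finite partition $P$ of $K$ there is a non-empty finite $u\subseteq K$ with $\left|\frac{|u\cap B|}{|u|}-\Xi(B)\right|<\varepsilon$ for all $B\in P$. *)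

theory Defs
  imports Complex_Main "HOL-Library.Extended_Real" "HOL-Library.FuncSet"
    "HOL-Library.Disjoint_Sets" "HOL-Library.Sublist"
begin

text \<open>Nodes, i.e. elements of \<open>\<omega>\<^sup><\<^sup>\<omega>\<close>, are lists of natural numbers, trees are prefix-closed sets of
  nodes, and the height of a node is its length.\<close>

type_synonym node = "nat list"

subsection \<open>Norms\<close>

definition set_norm :: "'c set \<Rightarrow> ('c set \<Rightarrow> ereal) \<Rightarrow> bool" where
  "set_norm C \<nu> \<longleftrightarrow>
     (\<forall>A. A \<subseteq> C \<longrightarrow> 0 \<le> \<nu> A) \<and>
     (\<forall>A B. A \<subseteq> B \<longrightarrow> B \<subseteq> C \<longrightarrow> \<nu> A \<le> \<nu> B) \<and>
     \<nu> {} = 0"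

text \<open>Finite index sets are taken to be sets of natural numbers, without loss of generality. They are
  nonempty because \<open>g\<close> sums to \<open>1\<close>. The difference is taken in the extended reals, without
  truncation at \<open>0\<close>.\<close>

definition co_big :: "nat \<Rightarrow> 'c set \<Rightarrow> ('c set \<Rightarrow> ereal) \<Rightarrow> bool" where
  "co_big m C \<nu> \<longleftrightarrow>
     m > 1 \<and> set_norm C \<nu> \<and>
     (\<forall>(I :: nat set) (A :: nat \<Rightarrow> 'c set) (g :: nat \<Rightarrow> real) (\<epsilon> :: real).
        finite I \<longrightarrow> (\<forall>i\<in>I. A i \<subseteq> C) \<longrightarrow> (\<forall>i\<in>I. g i \<in> {0..1}) \<longrightarrow> (\<Sum>i\<in>I. g i) = 1 \<longrightarrow> \<epsilon> > 0 \<longrightarrow>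
        \<nu> {k \<in> C. (\<Sum>i\<in>{i \<in> I. k \<in> A i}. g i) > 1 - \<epsilon>}
          \<ge> Min ((\<lambda>i. \<nu> (A i)) ` I) - ereal (log (real m) (1 / \<epsilon>)))"

subsection \<open>Trees and tree-creature frames\<close>

definition is_tree :: "node set \<Rightarrow> bool" where
  "is_tree T \<longleftrightarrow> T \<noteq> {} \<and> (\<forall>t\<in>T. \<forall>s. prefix s t \<longrightarrow> s \<in> T)"

definition succs :: "node set \<Rightarrow> node \<Rightarrow> node set" where
  "succs T t = {u \<in> T. \<exists>n. u = t @ [n]}"

definition Lev :: "nat \<Rightarrow> node set \<Rightarrow> node set" where
  "Lev n T = {t \<in> T. length t = n}"

text \<open>Height \<open>\<omega>\<close> and the root \<open>[]\<close> come for free from being a tree without maximal nodes. All levels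
  are finite and nonempty, so that \<open>Min\<close> is meaningful.\<close>

definition tree_creature_frame ::
    "node set \<Rightarrow> (node \<Rightarrow> nat) \<Rightarrow> (node \<Rightarrow> node set \<Rightarrow> ereal) \<Rightarrow> bool" where
  "tree_creature_frame T b N \<longleftrightarrow>
     is_tree T \<and>
     (\<forall>t\<in>T. finite (succs T t) \<and> succs T t \<noteq> {}) \<and>
     filterlim (\<lambda>n. Min (b ` Lev n T)) at_top sequentially \<and>
     (\<forall>t\<in>T. co_big (b t) (succs T t) (N t) \<and>
             (\<forall>u\<in>succs T t. N t {u} < 1) \<and>
             N t (succs T t) = \<infinity>)"

subsection \<open>The forcing notion\<close>

text \<open>Only used for subtrees of a finitely branching tree, where \<open>card\<close> counts the successors
  correctly. A stem, if it exists, is then unique.\<close>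

definition is_stem :: "node set \<Rightarrow> node \<Rightarrow> bool" where
  "is_stem p s \<longleftrightarrow>
     s \<in> p \<and> card (succs p s) \<ge> 2 \<and>
     (\<forall>t\<in>p. card (succs p t) \<ge> 2 \<longrightarrow> length s \<le> length t)"

definition stem :: "node set \<Rightarrow> node" where
  "stem p = (THE s. is_stem p s)"

text \<open>The quotient is one of extended reals, where \<open>1 / 0 = \<infinity>\<close>. The order on the conditions is \<open>\<subseteq>\<close>.\<close>

definition EE :: "node set \<Rightarrow> (node \<Rightarrow> node set \<Rightarrow> ereal) \<Rightarrow> node set set" where
  "EE T N = {p. is_tree p \<and> p \<subseteq> T \<and> (\<exists>s. is_stem p s) \<and>
     (\<forall>t\<in>p. prefix (stem p) t \<longrightarrow>
        N t (succs p t) \<ge> 1 + 1 / ereal (real (length (stem p))))}"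

text \<open>Only used for \<open>s \<noteq> []\<close>.\<close>

definition EE' ::
    "node set \<Rightarrow> (node \<Rightarrow> nat) \<Rightarrow> (node \<Rightarrow> node set \<Rightarrow> ereal) \<Rightarrow> node \<Rightarrow> node set set" where
  "EE' T b N s = {p \<in> EE T N. stem p = s \<and>
     (\<forall>t\<in>p. prefix s t \<longrightarrow>
        N t (succs p t) \<ge>
          ereal (1 + 1 / real (length s) + 4 * log (real (b t)) (real (length t))))}"

subsection \<open>Finitely additive measures\<close>

definition fam :: "'k set \<Rightarrow> ('k set \<Rightarrow> real) \<Rightarrow> bool" where
  "fam K \<Xi> \<longleftrightarrow>
     (\<forall>a. a \<subseteq> K \<longrightarrow> \<Xi> a \<in> {0..1}) \<and> \<Xi> {} = 0 \<and> \<Xi> K = 1 \<and>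
     (\<forall>a b. a \<subseteq> K \<longrightarrow> b \<subseteq> K \<longrightarrow> a \<inter> b = {} \<longrightarrow> \<Xi> (a \<union> b) = \<Xi> a + \<Xi> b)"

definition approximates :: "'k set \<Rightarrow> 'k set set \<Rightarrow> real \<Rightarrow> ('k set \<Rightarrow> real) \<Rightarrow> bool" where
  "approximates u P \<epsilon> \<Xi> \<longleftrightarrow>
     (\<forall>B\<in>P. \<bar>real (card (u \<inter> B)) / real (card u) - \<Xi> B\<bar> < \<epsilon>)"

definition uap :: "'k set \<Rightarrow> ('k set \<Rightarrow> real) \<Rightarrow> bool" where
  "uap K \<Xi> \<longleftrightarrow>
     (\<forall>\<epsilon>>0. \<forall>P. finite P \<and> partition_on K P \<longrightarrow>
        (\<exists>u. finite u \<and> u \<noteq> {} \<and> u \<subseteq> K \<and> approximates u P \<epsilon> \<Xi>))"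

text \<open>The blocks are nonempty (by \<open>partition_on\<close>) and pairwise disjoint, also as an indexed family.\<close>

definition finite_block_partition :: "'w set \<Rightarrow> 'k set \<Rightarrow> ('k \<Rightarrow> 'w set) \<Rightarrow> bool" where
  "finite_block_partition W K I \<longleftrightarrow>
     partition_on W (I ` K) \<and> inj_on I K \<and> (\<forall>k\<in>K. finite (I k))"

end

theory Submission imports Defs begin

text \<open>Averaging the relative size of a set in the blocks \<open>I\<^sub>k\<close> over finite \<open>u \<subseteq> K\<close> that approximate
  \<open>\<Xi>\<close> better and better yields in the limit a finitely additive measure \<open>\<mu>\<close> on \<open>W\<close>. The limit of
  \<open>r\<close> consists of the nodes \<open>t\<close> above \<open>s\<close> along which the measure of \<open>X\<^sub>t = {l. t \<in> r\<^sub>l}\<close>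
  shrinks by at most a factor \<open>1 - 1 / m\<^sup>2\<close> at each level \<open>m\<close>. Co-bigness is an averaging principle that turns
  the reserve \<open>4 log |t|\<close> in the norm of the conditions in \<open>E'\<^sub>s\<close> into sufficiently many such successors, and
  the product of the factors keeps \<open>\<mu> X\<^sub>t \<ge> 1 - 1 / |s|\<close>.

  Given \<open>q\<close> below the limits, fix \<open>t\<^sub>0 \<in> q\<close> of large height and then \<open>u\<close> whose block average is close to
  \<open>\<mu>\<close> on the sets \<open>X\<^sub>t\<close> for \<open>t = t\<^sub>0\<close>. The same averaging, applied to this block average, gives a path in \<open>q\<close> from \<open>t\<^sub>0\<close>
  to a node \<open>t\<^sub>1\<close> so high that intersecting \<open>q\<close> with all of the finitely many \<open>r\<^sub>l\<close> that contain
  \<open>t\<^sub>1\<close> costs less norm than the longer stem allows.\<close>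

subsection \<open>Finitely additive measures\<close>

lemma fam_nonneg: "fam K \<mu> \<Longrightarrow> X \<subseteq> K \<Longrightarrow> 0 \<le> \<mu> X"
  by (auto simp: fam_def)

lemma fam_le_one: "fam K \<mu> \<Longrightarrow> X \<subseteq> K \<Longrightarrow> \<mu> X \<le> 1"
  by (auto simp: fam_def)

lemma fam_Un:
  "fam K \<mu> \<Longrightarrow> X \<subseteq> K \<Longrightarrow> Y \<subseteq> K \<Longrightarrow> X \<inter> Y = {} \<Longrightarrow> \<mu> (X \<union> Y) = \<mu> X + \<mu> Y"
  by (simp add: fam_def)

lemma fam_mono:
  assumes "fam K \<mu>" "X \<subseteq> Y" "Y \<subseteq> K"
  shows "\<mu> X \<le> \<mu> Y"
proof -
  have "\<mu> (X \<union> (Y - X)) = \<mu> X + \<mu> (Y - X)"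
    using assms by (intro fam_Un[OF assms(1)]) auto
  moreover have "X \<union> (Y - X) = Y" using assms by auto
  ultimately show ?thesis using fam_nonneg[OF assms(1), of "Y - X"] assms by auto
qed

lemma fam_UNION:
  assumes "fam K \<mu>" "finite J" "\<And>j. j \<in> J \<Longrightarrow> B j \<subseteq> K" "disjoint_family_on B J"
  shows "\<mu> (\<Union>j\<in>J. B j) = (\<Sum>j\<in>J. \<mu> (B j))"
  using assms(2-4)
proof (induction J rule: finite_induct)
  case empty
  then show ?case using assms(1) by (simp add: fam_def)
next
  case (insert j J)
  have "B j \<inter> (\<Union>j\<in>J. B j) = {}"
    using insert.prems(2) insert.hyps by (fastforce simp: disjoint_family_on_def)
  then have "\<mu> (B j \<union> (\<Union>j\<in>J. B j)) = \<mu> (B j) + \<mu> (\<Union>j\<in>J. B j)"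
    using insert.prems by (intro fam_Un[OF assms(1)]) auto
  moreover have "disjoint_family_on B J"
    using insert.prems(2) by (auto simp: disjoint_family_on_def)
  ultimately show ?case using insert by simp
qed

text \<open>Serves three purposes: it measures the approximating sets \<open>u\<close>, the single
  blocks, and the index set in \<open>co_big_Inter\<close>.\<close>

lemma fam_uniform:
  assumes "finite u" "u \<noteq> {}" "u \<subseteq> K"
  shows "fam K (\<lambda>B. real (card (u \<inter> B)) / real (card u))"
  unfolding fam_def
proof (intro conjI allI impI)
  have c: "card u > 0" using assms by (simp add: card_gt_0_iff)
  show "real (card (u \<inter> a)) / real (card u) \<in> {0..1}" for a
    using assms c by (auto simp: card_mono)
  show "real (card (u \<inter> K)) / real (card u) = 1"
    using assms c by (simp add: Int_absorb2)
  show "real (card (u \<inter> (x \<union> y))) / real (card u)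
      = real (card (u \<inter> x)) / real (card u) + real (card (u \<inter> y)) / real (card u)"
    if "x \<inter> y = {}" for x y
  proof -
    have "card (u \<inter> (x \<union> y)) = card (u \<inter> x) + card (u \<inter> y)"
      unfolding Int_Un_distrib using assms that by (intro card_Un_disjoint) auto
    then show ?thesis by (simp add: add_divide_distrib)
  qed
qed simp

section \<open>Averages over the blocks of a partition\<close>

definition block_avg :: "('k \<Rightarrow> 'w set) \<Rightarrow> 'k set \<Rightarrow> 'w set \<Rightarrow> real" where
  "block_avg I u X = (\<Sum>k\<in>u. real (card (I k \<inter> X)) / real (card (I k))) / real (card u)"

lemma fam_block_avg:
  assumes "finite u" "u \<noteq> {}" "\<And>k. k \<in> u \<Longrightarrow> finite (I k) \<and> I k \<noteq> {} \<and> I k \<subseteq> W"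
  shows "fam W (block_avg I u)"
proof -
  have c: "card u > 0" using assms by (simp add: card_gt_0_iff)
  have f: "fam W (\<lambda>X. real (card (I k \<inter> X)) / real (card (I k)))" if "k \<in> u" for k
    using assms(3)[OF that] by (intro fam_uniform) auto
  show ?thesis
    unfolding fam_def
  proof (intro conjI allI impI)
    show "block_avg I u X \<in> {0..1}" if "X \<subseteq> W" for X
    proof -
      have "(\<Sum>k\<in>u. real (card (I k \<inter> X)) / real (card (I k))) \<le> (\<Sum>k\<in>u. 1)"
        using fam_le_one[OF f that] by (intro sum_mono) auto
      then show ?thesis using c by (auto simp: block_avg_def sum_nonneg)
    qed
    have "(\<Sum>k\<in>u. real (card (I k \<inter> W)) / real (card (I k))) = (\<Sum>k\<in>u. 1)"
    proof (rule sum.cong)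
      show "real (card (I k \<inter> W)) / real (card (I k)) = 1" if "k \<in> u" for k
        using f[OF that] unfolding fam_def by blast
    qed simp
    then show "block_avg I u W = 1" using c by (simp add: block_avg_def)
    show "block_avg I u (X \<union> Y) = block_avg I u X + block_avg I u Y"
      if "X \<subseteq> W" "Y \<subseteq> W" "X \<inter> Y = {}" for X Y
    proof -
      have "(\<Sum>k\<in>u. real (card (I k \<inter> (X \<union> Y))) / real (card (I k))) =
          (\<Sum>k\<in>u. real (card (I k \<inter> X)) / real (card (I k)) + real (card (I k \<inter> Y)) / real (card (I k)))"
        using fam_Un[OF f that] by (intro sum.cong) auto
      then show ?thesis by (simp only: block_avg_def sum.distrib add_divide_distrib)
    qed
  qed (simp add: block_avg_def)
qed

text \<open>The uap speaks of partitions only, so it is applied to the atoms of the algebra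
  generated by the family. Every member is a finite union of atoms, and the errors on the atoms add
  up.\<close>

lemma uap_finite_family:
  assumes "fam K \<Xi>" "uap K \<Xi>" "finite \<S>" "\<And>S. S \<in> \<S> \<Longrightarrow> S \<subseteq> K" "\<epsilon> > 0"
  shows "\<exists>u. finite u \<and> u \<noteq> {} \<and> u \<subseteq> K \<and> approximates u \<S> \<epsilon> \<Xi>"
proof -
  \<comment> \<open>The membership pattern of a point; the atoms are the nonempty fibres of
    \<open>sig\<close>.\<close>
  define sig where "sig k = {S \<in> \<S>. k \<in> S}" for k
  define P where "P = (\<lambda>c. {k \<in> K. sig k = c}) ` Pow \<S> - {{}}"
  have finP: "finite P" unfolding P_def using assms(3) by auto
  have part: "partition_on K P"
  proof (rule partition_onI)
    show "\<Union>P = K"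
    proof
      show "K \<subseteq> \<Union>P"
      proof
        fix k assume "k \<in> K"
        then have "{j \<in> K. sig j = sig k} \<in> P" "k \<in> {j \<in> K. sig j = sig k}"
          by (auto simp: P_def sig_def)
        then show "k \<in> \<Union>P" by blast
      qed
    qed (auto simp: P_def)
    show "disjnt p p'" if pp: "p \<in> P" "p' \<in> P" "p \<noteq> p'" for p p'
    proof -
      obtain c c' where "p = {k \<in> K. sig k = c}" "p' = {k \<in> K. sig k = c'}"
        using pp(1,2) unfolding P_def by blast
      then show ?thesis using pp(3) by (auto simp: disjnt_def)
    qed
  qed (simp add: P_def)
  \<comment> \<open>At most \<open>card P\<close> atoms contribute an error \<open>\<delta>\<close>
    each; the summand \<open>1\<close> makes the total strictly smaller than
    \<open>\<epsilon>\<close>.\<close>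
  define \<delta> where "\<delta> = \<epsilon> / (real (card P) + 1)"
  have \<delta>: "\<delta> > 0" unfolding \<delta>_def using assms(5) by simp
  obtain u where u: "finite u" "u \<noteq> {}" "u \<subseteq> K" "approximates u P \<delta> \<Xi>"
    using assms(2)[unfolded uap_def, rule_format, OF \<delta>, of P] finP part by blast
  have "\<bar>real (card (u \<inter> S)) / real (card u) - \<Xi> S\<bar> < \<epsilon>" if S: "S \<in> \<S>" for S
  proof -
    define Q where "Q = {B \<in> P. B \<subseteq> S}"
    have finQ: "finite Q" unfolding Q_def using finP by auto
    have "S \<subseteq> \<Union>Q"
    proof
      fix k assume k: "k \<in> S"
      have "{j \<in> K. sig j = sig k} \<in> Q"
        unfolding Q_def P_def using k S assms(4)[OF S] by (auto simp: sig_def)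
      moreover have "k \<in> {j \<in> K. sig j = sig k}" using k assms(4)[OF S] by auto
      ultimately show "k \<in> \<Union>Q" by blast
    qed
    then have SQ: "S = (\<Union>B\<in>Q. B)" unfolding Q_def by auto
    have dis: "disjoint_family_on (\<lambda>B. B) Q"
      using part unfolding Q_def partition_on_def disjoint_family_on_def disjoint_def by blast
    have sub: "\<And>B. B \<in> Q \<Longrightarrow> B \<subseteq> K" using assms(4)[OF S] unfolding Q_def by auto
    have "real (card (u \<inter> S)) / real (card u) = (\<Sum>B\<in>Q. real (card (u \<inter> B)) / real (card u))"
      using fam_UNION[OF fam_uniform[OF u(1-3)] finQ sub dis] SQ by simp
    moreover have "\<Xi> S = (\<Sum>B\<in>Q. \<Xi> B)"
      using fam_UNION[OF assms(1) finQ sub dis] SQ by simp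
    ultimately have "\<bar>real (card (u \<inter> S)) / real (card u) - \<Xi> S\<bar>
        = \<bar>\<Sum>B\<in>Q. real (card (u \<inter> B)) / real (card u) - \<Xi> B\<bar>"
      by (simp add: sum_subtractf)
    also have "\<dots> \<le> (\<Sum>B\<in>Q. \<delta>)"
      by (rule order_trans[OF sum_abs sum_mono])
         (use u(4) in \<open>auto simp: Q_def approximates_def less_imp_le\<close>)
    also have "\<dots> \<le> real (card P) * \<delta>"
      using card_mono[OF finP, of Q] \<delta> by (simp add: Q_def mult_right_mono)
    also have "\<dots> < \<epsilon>"
      unfolding \<delta>_def using assms(5) by (simp add: field_simps)
    finally show ?thesis .
  qed
  then show ?thesis using u unfolding approximates_def by blast
qed

section \<open>Limits along finite sets that approximate a measure\<close>

definition approx_filter :: "'k set \<Rightarrow> ('k set \<Rightarrow> real) \<Rightarrow> 'k set filter" where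
  "approx_filter K \<Xi> = (INF (\<S>, \<epsilon>)\<in>{\<S>. finite \<S> \<and> \<S> \<subseteq> Pow K} \<times> {0<..}.
     principal {u. finite u \<and> u \<noteq> {} \<and> u \<subseteq> K \<and> approximates u \<S> \<epsilon> \<Xi>})"

text \<open>The generating sets are directed: the union of two families with the smaller of the two
  precisions refines both. Hence they form a base, and one family with one precision witnesses each
  eventual property.\<close>

lemma eventually_approx_filter:
  "eventually Q (approx_filter K \<Xi>) \<longleftrightarrow>
     (\<exists>\<S> \<epsilon>. finite \<S> \<and> \<S> \<subseteq> Pow K \<and> \<epsilon> > 0 \<and>
       (\<forall>u. finite u \<longrightarrow> u \<noteq> {} \<longrightarrow> u \<subseteq> K \<longrightarrow> approximates u \<S> \<epsilon> \<Xi> \<longrightarrow> Q u))"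
proof -
  let ?B = "{\<S>. finite \<S> \<and> \<S> \<subseteq> Pow K} \<times> {0 :: real<..}"
  have ne: "?B \<noteq> {}"
    using gt_ex[of "0 :: real"] by (auto simp: ex_in_conv[symmetric])
  show ?thesis
    unfolding approx_filter_def
  proof (subst eventually_INF_base[OF ne], goal_cases)
    case (1 a b)
    then obtain S e T d where ab: "a = (S, e)" "b = (T, d)" by force
    have "(S \<union> T, min e d) \<in> ?B" using 1 ab by auto
    moreover have "(case (S \<union> T, min e d) of (\<S>, \<epsilon>) \<Rightarrow>
         principal {u. finite u \<and> u \<noteq> {} \<and> u \<subseteq> K \<and> approximates u \<S> \<epsilon> \<Xi>})
       \<le> inf (case a of (\<S>, \<epsilon>) \<Rightarrow> principal {u. finite u \<and> u \<noteq> {} \<and> u \<subseteq> K \<and> approximates u \<S> \<epsilon> \<Xi>})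
             (case b of (\<S>, \<epsilon>) \<Rightarrow> principal {u. finite u \<and> u \<noteq> {} \<and> u \<subseteq> K \<and> approximates u \<S> \<epsilon> \<Xi>})"
      unfolding ab by (auto simp: approximates_def)
    ultimately show ?case by blast
  next
    case 2
    show ?case
      unfolding bex_simps Bex_def split_paired_Ex mem_Times_iff fst_conv snd_conv case_prod_conv
        eventually_principal mem_Collect_eq greaterThan_iff Ball_def
      by (simp add: imp_conjL)
  qed
qed

text \<open>This is the point where the uap enters: it makes every basic set nonempty, so that
  limits along the filter are unique.\<close>

lemma approx_filter_neq_bot:
  assumes "fam K \<Xi>" "uap K \<Xi>"
  shows "approx_filter K \<Xi> \<noteq> bot"
proof
  assume "approx_filter K \<Xi> = bot"
  then have "eventually (\<lambda>_. False) (approx_filter K \<Xi>)" by simp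
  then obtain \<S> \<epsilon> where *: "finite \<S>" "\<S> \<subseteq> Pow K" "\<epsilon> > 0"
    and no: "\<And>u. finite u \<Longrightarrow> u \<noteq> {} \<Longrightarrow> u \<subseteq> K \<Longrightarrow> approximates u \<S> \<epsilon> \<Xi> \<Longrightarrow> False"
    unfolding eventually_approx_filter by (elim exE conjE) metis
  from uap_finite_family[OF assms *(1) _ *(3)] *(2)
  obtain u where "finite u" "u \<noteq> {}" "u \<subseteq> K" "approximates u \<S> \<epsilon> \<Xi>" by auto
  then show False by (rule no)
qed

text \<open>The thresholds met are the first \<open>i\<close>, where \<open>i\<close> is the integer
  part of \<open>m * x\<close>, so the error is one of rounding. A function is thereby replaced by
  its superlevel sets, on which \<open>approximates\<close> can act.\<close>

lemma layer_cake:
  fixes x :: real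
  assumes "0 \<le> x" "x \<le> 1" "m > 0"
  shows "\<bar>x - (\<Sum>j\<in>{1..m}. of_bool (real j / real m \<le> x)) / real m\<bar> \<le> 1 / real m"
proof -
  define i where "i = nat \<lfloor>real m * x\<rfloor>"
  have i1: "real i \<le> real m * x" "real m * x < real i + 1"
    unfolding i_def using assms by (auto simp: of_nat_nat)
  have "real i \<le> real m"
    using i1 assms mult_left_le[of x "real m"] by linarith
  then have im: "i \<le> m" by simp
  have *: "real j / real m \<le> x \<longleftrightarrow> j \<le> i" for j
  proof -
    have "real j / real m \<le> x \<longleftrightarrow> real j \<le> real m * x"
      using assms by (simp add: pos_divide_le_eq mult.commute)
    also have "\<dots> \<longleftrightarrow> j \<le> i" using i1 by linarith
    finally show ?thesis .
  qed
  have "{1..m} \<inter> {j. j \<le> i} = {1..i}" using im by auto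
  then have e: "(\<Sum>j\<in>{1..m}. of_bool (real j / real m \<le> x)) = real i"
    by (simp add: * sum_of_bool_eq)
  have "x - real i / real m = (real m * x - real i) / real m" using assms by (simp add: field_simps)
  moreover have "0 \<le> (real m * x - real i) / real m" "(real m * x - real i) / real m \<le> 1 / real m"
    using i1 by (auto intro!: divide_nonneg_nonneg divide_right_mono)
  ultimately show ?thesis unfolding e by simp
qed

text \<open>The average of \<open>f\<close> over \<open>u\<close> is within \<open>1 / m\<close> of
  the mean density of \<open>m\<close> superlevel sets in \<open>u\<close>, and these densities are
  eventually close to their \<open>\<Xi>\<close>-values. Each of the two errors gets half of
  \<open>e\<close>.\<close>

lemma eventually_avg_near:
  assumes f: "\<And>k. k \<in> K \<Longrightarrow> 0 \<le> f k \<and> f k \<le> 1" and e: "e > (0 :: real)"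
  shows "\<exists>c. eventually (\<lambda>u. \<bar>(\<Sum>k\<in>u. f k) / real (card u) - c\<bar> < e) (approx_filter K \<Xi>)"
proof -
  obtain m :: nat where m: "m > 0" "1 / real m < e / 2"
    using e by (metis half_gt_zero nat_approx_posE of_nat_0_less_iff zero_less_Suc)
  define S where "S j = {k \<in> K. real j / real m \<le> f k}" for j
  \<comment> \<open>A Riemann sum for the integral of \<open>f\<close> against
    \<open>\<Xi>\<close>.\<close>
  define c where "c = (\<Sum>j\<in>{1..m}. \<Xi> (S j)) / real m"
  have "\<bar>(\<Sum>k\<in>u. f k) / real (card u) - c\<bar> < e"
    if u: "finite u" "u \<noteq> {}" "u \<subseteq> K" and a: "approximates u (S ` {1..m}) (e / 2) \<Xi>" for u
  proof -
    have cu: "card u > 0" using u by (simp add: card_gt_0_iff)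
    define d where "d = (\<Sum>j\<in>{1..m}. real (card (u \<inter> S j)) / real (card u)) / real m"
    have "\<bar>d - c\<bar> = \<bar>\<Sum>j\<in>{1..m}. real (card (u \<inter> S j)) / real (card u) - \<Xi> (S j)\<bar> / real m"
      unfolding d_def c_def by (simp add: sum_subtractf diff_divide_distrib[symmetric])
    also have "\<dots> \<le> (\<Sum>j\<in>{1..m}. e / 2) / real m"
      by (intro divide_right_mono order_trans[OF sum_abs sum_mono])
         (use a in \<open>auto simp: approximates_def less_imp_le\<close>)
    also have "\<dots> = e / 2" using m by simp
    finally have 1: "\<bar>d - c\<bar> \<le> e / 2" .
    have "u \<inter> S j = u \<inter> {k. real j / real m \<le> f k}" for j
      using u by (auto simp: S_def)
    then have "real (card (u \<inter> S j)) = (\<Sum>k\<in>u. of_bool (real j / real m \<le> f k))" for j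
      using u by (simp add: sum_of_bool_eq)
    \<comment> \<open>Exchanging the sums turns the sizes of the superlevel sets into a pointwise
      expression, to which \<open>layer_cake\<close> applies.\<close>
    then have "d = (\<Sum>k\<in>u. (\<Sum>j\<in>{1..m}. of_bool (real j / real m \<le> f k)) / real m) / real (card u)"
      unfolding d_def sum_divide_distrib[symmetric] by (simp add: sum.swap[of _ u])
    then have "\<bar>(\<Sum>k\<in>u. f k) / real (card u) - d\<bar> =
       \<bar>\<Sum>k\<in>u. f k - (\<Sum>j\<in>{1..m}. of_bool (real j / real m \<le> f k)) / real m\<bar> / real (card u)"
      by (simp add: sum_subtractf diff_divide_distrib[symmetric])
    also have "\<dots> \<le> (\<Sum>k\<in>u. 1 / real m) / real (card u)"
      by (intro divide_right_mono order_trans[OF sum_abs sum_mono] layer_cake)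
         (use f u m in auto)
    also have "\<dots> = 1 / real m" using cu by simp
    finally show ?thesis using 1 m by linarith
  qed
  then have "eventually (\<lambda>u. \<bar>(\<Sum>k\<in>u. f k) / real (card u) - c\<bar> < e) (approx_filter K \<Xi>)"
    unfolding eventually_approx_filter
    by (intro exI[of _ "S ` {1..m}"] exI[of _ "e / 2"]) (use e in \<open>auto simp: S_def\<close>)
  then show ?thesis ..
qed


text \<open>The limit plays the role of the integral of \<open>f\<close> against
  \<open>\<Xi>\<close>. By \<open>eventually_avg_near\<close> the averages are Cauchy along the
  filter, and the reals are complete.\<close>

lemma avg_convergent:
  assumes "fam K \<Xi>" "uap K \<Xi>" and f: "\<And>k. k \<in> K \<Longrightarrow> 0 \<le> f k \<and> f k \<le> (1 :: real)"
  shows "\<exists>c. ((\<lambda>u. (\<Sum>k\<in>u. f k) / real (card u)) \<longlongrightarrow> c) (approx_filter K \<Xi>)"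
proof -
  let ?A = "\<lambda>u. (\<Sum>k\<in>u. f k) / real (card u)"
  have "cauchy_filter (filtermap ?A (approx_filter K \<Xi>))"
    unfolding cauchy_filter_metric_filtermap
  proof (intro allI impI)
    fix e :: real assume e: "e > 0"
    obtain c where c: "eventually (\<lambda>u. \<bar>?A u - c\<bar> < e / 2) (approx_filter K \<Xi>)"
      using eventually_avg_near[of K f "e / 2"] f e half_gt_zero by blast
    show "\<exists>P. eventually P (approx_filter K \<Xi>) \<and> (\<forall>x y. P x \<and> P y \<longrightarrow> dist (?A x) (?A y) < e)"
      by (intro exI[of _ "\<lambda>u. \<bar>?A u - c\<bar> < e / 2"] conjI c allI impI)
         (simp only: dist_real_def, linarith)
  qed
  moreover have "filtermap ?A (approx_filter K \<Xi>) \<noteq> bot"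
    using approx_filter_neq_bot[OF assms(1,2)] by (simp add: filtermap_bot_iff)
  moreover have "complete (UNIV :: real set)"
    unfolding complete_def by (auto dest: Cauchy_convergent simp: convergent_def)
  ultimately show ?thesis
    unfolding filterlim_def complete_uniform by (metis UNIV_I principal_UNIV top_greatest)
qed

section \<open>The limit measure on the index set \<open>W\<close>\<close>

lemma finite_block_partitionD:
  "finite_block_partition W K I \<Longrightarrow> k \<in> K \<Longrightarrow> finite (I k) \<and> I k \<noteq> {} \<and> I k \<subseteq> W"
  unfolding finite_block_partition_def partition_on_def by blast

text \<open>The interface to the forcing argument: a single \<open>u\<close> approximates
  \<open>\<Xi>\<close> on \<open>P\<close> and, at the same time, \<open>\<mu>\<close> on finitely
  many sets.\<close>

definition block_limit ::
    "'k set \<Rightarrow> ('k set \<Rightarrow> real) \<Rightarrow> ('k \<Rightarrow> 'w set) \<Rightarrow> ('w set \<Rightarrow> real) \<Rightarrow> bool" where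
  "block_limit K \<Xi> I \<mu> \<longleftrightarrow>
     (\<forall>P \<X> \<epsilon>. finite P \<longrightarrow> P \<subseteq> Pow K \<longrightarrow> finite \<X> \<longrightarrow> \<epsilon> > 0 \<longrightarrow>
       (\<exists>u. finite u \<and> u \<noteq> {} \<and> u \<subseteq> K \<and> approximates u P \<epsilon> \<Xi> \<and>
         (\<forall>X\<in>\<X>. \<bar>block_avg I u X - \<mu> X\<bar> < \<epsilon>)))"

text \<open>\<open>\<mu>\<close> is the pointwise limit of the block averages, and the laws of a fam
  pass to limits. Since the filter is proper, finitely many eventual properties have a common
  witness \<open>u\<close>.\<close>

lemma ex_limit_fam:
  assumes \<Xi>: "fam K \<Xi>" "uap K \<Xi>"
    and fbp: "finite_block_partition W K I"
  shows "\<exists>\<mu>. fam W \<mu> \<and> block_limit K \<Xi> I \<mu>"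
proof -
  let ?F = "approx_filter K \<Xi>"
  note I = finite_block_partitionD[OF fbp]
  have ne: "?F \<noteq> bot" by (rule approx_filter_neq_bot[OF \<Xi>])
  have conv: "\<exists>c. ((\<lambda>u. block_avg I u X) \<longlongrightarrow> c) ?F" for X
    unfolding block_avg_def
  proof (intro avg_convergent[OF \<Xi>])
    fix k assume "k \<in> K"
    then have "real (card (I k \<inter> X)) \<le> real (card (I k))"
      using I by (simp add: card_mono)
    then show "0 \<le> real (card (I k \<inter> X)) / real (card (I k)) \<and>
        real (card (I k \<inter> X)) / real (card (I k)) \<le> 1"
      by (auto simp: divide_le_eq_1)
  qed
  define \<mu> where "\<mu> X = Lim ?F (\<lambda>u. block_avg I u X)" for X
  have lim: "((\<lambda>u. block_avg I u X) \<longlongrightarrow> \<mu> X) ?F" for X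
    using conv[of X] tendsto_Lim[OF ne] unfolding \<mu>_def by metis
  have good: "eventually (\<lambda>u. finite u \<and> u \<noteq> {} \<and> u \<subseteq> K) ?F"
    unfolding eventually_approx_filter by (intro exI[of _ "{}"] exI[of _ 1]) auto
  have fam_u: "fam W (block_avg I u)" if "finite u \<and> u \<noteq> {} \<and> u \<subseteq> K" for u
    using that I by (intro fam_block_avg) auto
  have unique: "\<mu> X = c" if "((\<lambda>u. block_avg I u X) \<longlongrightarrow> c) ?F" for X c
    using tendsto_unique[OF ne lim that] .
  have "fam W \<mu>"
    unfolding fam_def
  proof (intro conjI allI impI)
    show "\<mu> X \<in> {0..1}" if X: "X \<subseteq> W" for X
    proof -
      have "\<mu> X \<ge> 0"
        by (rule tendsto_lowerbound[OF lim _ ne])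
           (use good in \<open>rule eventually_mono, use fam_nonneg[OF fam_u X] in blast\<close>)
      moreover have "\<mu> X \<le> 1"
        by (rule tendsto_upperbound[OF lim _ ne])
           (use good in \<open>rule eventually_mono, use fam_le_one[OF fam_u X] in blast\<close>)
      ultimately show ?thesis by simp
    qed
    show "\<mu> {} = 0" by (rule unique) (simp add: block_avg_def)
    show "\<mu> W = 1"
      by (rule unique, rule tendsto_eventually, use good in \<open>rule eventually_mono\<close>)
         (use fam_u in \<open>auto simp: fam_def\<close>)
    show "\<mu> (X \<union> Y) = \<mu> X + \<mu> Y" if XY: "X \<subseteq> W" "Y \<subseteq> W" "X \<inter> Y = {}" for X Y
    proof (rule unique)
      have "eventually (\<lambda>u. block_avg I u X + block_avg I u Y = block_avg I u (X \<union> Y)) ?F"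
        using good by (rule eventually_mono) (use fam_Un[OF fam_u XY] in auto)
      then show "((\<lambda>u. block_avg I u (X \<union> Y)) \<longlongrightarrow> \<mu> X + \<mu> Y) ?F"
        by (rule Lim_transform_eventually[OF tendsto_add[OF lim lim]])
    qed
  qed
  moreover have "\<exists>u. finite u \<and> u \<noteq> {} \<and> u \<subseteq> K \<and> approximates u P \<epsilon> \<Xi> \<and>
       (\<forall>X\<in>\<X>. \<bar>block_avg I u X - \<mu> X\<bar> < \<epsilon>)"
    if P: "finite P" "P \<subseteq> Pow K" "finite \<X>" and \<epsilon>: "\<epsilon> > 0" for P \<X> \<epsilon>
  proof -
    have "eventually (\<lambda>u. approximates u P \<epsilon> \<Xi>) ?F"
      unfolding eventually_approx_filter using P \<epsilon> by blast
    moreover have "eventually (\<lambda>u. \<forall>X\<in>\<X>. \<bar>block_avg I u X - \<mu> X\<bar> < \<epsilon>) ?F"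
      using P(3) tendstoD[OF lim \<epsilon>] by (simp add: eventually_ball_finite_distrib dist_real_def)
    ultimately have "eventually (\<lambda>u. (finite u \<and> u \<noteq> {} \<and> u \<subseteq> K) \<and> approximates u P \<epsilon> \<Xi> \<and>
       (\<forall>X\<in>\<X>. \<bar>block_avg I u X - \<mu> X\<bar> < \<epsilon>)) ?F"
      using good by eventually_elim auto
    from eventually_happens'[OF ne this] show ?thesis by auto
  qed
  ultimately show ?thesis unfolding block_limit_def by (intro exI[of _ \<mu>] conjI allI impI)
qed

subsection \<open>Co-big norms\<close>

lemma co_big_mono:
  "co_big m C \<nu> \<Longrightarrow> A \<subseteq> B \<Longrightarrow> B \<subseteq> C \<Longrightarrow> \<nu> A \<le> \<nu> B"
  unfolding co_big_def set_norm_def by blast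

text \<open>As \<open>C\<close> is finite, \<open>A\<close> takes only finitely many values, even on
  an infinite \<open>X\<close>. Grouping the indices by value and taking the relative measures of
  the groups as weights gives an instance of co-bigness.\<close>

lemma co_big_average:
  assumes cb: "co_big m C \<nu>" and C: "finite C" "\<nu> C = \<infinity>"
    and \<mu>: "fam W \<mu>" and X: "X \<subseteq> W"
    and A: "\<And>l. l \<in> X \<Longrightarrow> A l \<subseteq> C" "\<And>l. l \<in> X \<Longrightarrow> c \<le> \<nu> (A l)" and \<epsilon>: "\<epsilon> > 0"
  shows "c - ereal (log (real m) (1 / \<epsilon>)) \<le> \<nu> {k \<in> C. (1 - \<epsilon>) * \<mu> X \<le> \<mu> {l \<in> X. k \<in> A l}}"
\<comment> \<open>For a null set the target set is all of \<open>C\<close>, of infinite norm;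
  otherwise one may divide by \<open>\<mu> X\<close>.\<close>
proof (cases "\<mu> X = 0")
  case True
  have "0 \<le> \<mu> {l \<in> X. k \<in> A l}" for k by (rule fam_nonneg[OF \<mu>]) (use X in auto)
  then show ?thesis using True C by simp
next
  case False
  then have pos: "\<mu> X > 0" using fam_nonneg[OF \<mu> X] by simp
  have "finite (A ` X)" using A(1) C(1) by (auto intro: finite_subset[of _ "Pow C"])
  then obtain e where e: "bij_betw e {0..<card (A ` X)} (A ` X)"
    using ex_bij_betw_nat_finite by blast
  define J where "J = {0..<card (A ` X)}"
  have eJ: "e ` J = A ` X" and inj: "inj_on e J" using e unfolding J_def bij_betw_def by auto
  define D where "D i = {l \<in> X. A l = e i}" for i
  define g where "g i = \<mu> (D i) / \<mu> X" for i
  have DW: "D i \<subseteq> W" "D i \<subseteq> X" for i using X by (auto simp: D_def)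
  have finJ: "finite J" by (simp add: J_def)
  have part: "(\<Sum>i\<in>{i \<in> J. Q (e i)}. g i) = \<mu> {l \<in> X. Q (A l)} / \<mu> X" for Q
  proof -
    have "{l \<in> X. Q (A l)} = (\<Union>i\<in>{i \<in> J. Q (e i)}. D i)"
    proof (intro equalityI subsetI)
      fix l assume l: "l \<in> {l \<in> X. Q (A l)}"
      then have "A l \<in> e ` J" using eJ by auto
      then obtain i where "i \<in> J" "A l = e i" by auto
      then show "l \<in> (\<Union>i\<in>{i \<in> J. Q (e i)}. D i)" using l by (auto simp: D_def)
    qed (auto simp: D_def)
    moreover have "disjoint_family_on D {i \<in> J. Q (e i)}"
      using inj by (auto simp: disjoint_family_on_def D_def inj_on_def)
    ultimately have "\<mu> {l \<in> X. Q (A l)} = (\<Sum>i\<in>{i \<in> J. Q (e i)}. \<mu> (D i))"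
      using fam_UNION[OF \<mu>, of "{i \<in> J. Q (e i)}" D] finJ DW by simp
    then show ?thesis by (simp add: g_def sum_divide_distrib)
  qed
  have sum1: "(\<Sum>i\<in>J. g i) = 1" using part[of "\<lambda>_. True"] pos by simp
  have g01: "\<forall>i\<in>J. g i \<in> {0..1}"
    unfolding g_def using pos fam_nonneg[OF \<mu> DW(1)] fam_mono[OF \<mu> DW(2) X] by auto
  have eC: "\<forall>i\<in>J. e i \<subseteq> C" and ec: "\<forall>i\<in>J. c \<le> \<nu> (e i)"
    using eJ A by (metis (no_types, lifting) imageE imageI)+
  have "J \<noteq> {}" using sum1 by auto
  then have "c \<le> Min ((\<lambda>i. \<nu> (e i)) ` J)" using finJ ec by simp
  then have "c - ereal (log (real m) (1 / \<epsilon>)) \<le> Min ((\<lambda>i. \<nu> (e i)) ` J) - ereal (log (real m) (1 / \<epsilon>))"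
    by (rule ereal_minus_mono) simp
  also have "\<dots> \<le> \<nu> {k \<in> C. (\<Sum>i\<in>{i \<in> J. k \<in> e i}. g i) > 1 - \<epsilon>}"
    using cb finJ eC g01 sum1 \<epsilon> unfolding co_big_def by blast
  also have "\<dots> \<le> \<nu> {k \<in> C. (1 - \<epsilon>) * \<mu> X \<le> \<mu> {l \<in> X. k \<in> A l}}"
    by (rule co_big_mono[OF cb]) (use pos in \<open>auto simp: part pos_less_divide_eq\<close>)
  finally show ?thesis .
qed

text \<open>Averaging with the uniform measure on \<open>J\<close> and precision
  \<open>1 / (n + 1)\<close>: a point that misses one of the \<open>n\<close> sets has weight at
  most \<open>1 - 1 / n\<close>, which is below the threshold.\<close>

lemma co_big_Inter:
  assumes cb: "co_big m C \<nu>" and C: "finite C" "\<nu> C = \<infinity>"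
    and J: "finite J" "J \<noteq> {}"
    and A: "\<And>j. j \<in> J \<Longrightarrow> A j \<subseteq> C" "\<And>j. j \<in> J \<Longrightarrow> c \<le> \<nu> (A j)"
  shows "c - ereal (log (real m) (real (card J) + 1)) \<le> \<nu> {k \<in> C. \<forall>j\<in>J. k \<in> A j}"
proof -
  define n where "n = card J"
  have n: "n > 0" using J by (simp add: n_def card_gt_0_iff)
  let ?\<mu> = "\<lambda>B. real (card (J \<inter> B)) / real (card J)"
  have "c - ereal (log (real m) (1 / (1 / (real n + 1))))
      \<le> \<nu> {k \<in> C. (1 - 1 / (real n + 1)) * ?\<mu> J \<le> ?\<mu> {j \<in> J. k \<in> A j}}"
    by (rule co_big_average[OF cb C fam_uniform[OF J]]) (use A in auto)
  also have "\<dots> \<le> \<nu> {k \<in> C. \<forall>j\<in>J. k \<in> A j}"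
  proof (rule co_big_mono[OF cb], safe)
    fix k j assume k: "(1 - 1 / (real n + 1)) * ?\<mu> J \<le> ?\<mu> {j \<in> J. k \<in> A j}" and j: "j \<in> J"
    show "k \<in> A j"
    proof (rule ccontr)
      assume "k \<notin> A j"
      then have "{j \<in> J. k \<in> A j} \<subset> J" using j by auto
      then have "card {j \<in> J. k \<in> A j} < n" unfolding n_def using J psubset_card_mono by blast
      then have "real (card {j \<in> J. k \<in> A j}) \<le> real n - 1" by linarith
      moreover have "J \<inter> {j \<in> J. k \<in> A j} = {j \<in> J. k \<in> A j}" by auto
      ultimately have "?\<mu> {j \<in> J. k \<in> A j} \<le> (real n - 1) / real n"
        by (simp add: n_def divide_right_mono)
      moreover have "(real n - 1) / real n < 1 - 1 / (real n + 1)"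
        using n by (simp add: field_simps)
      moreover have "?\<mu> J = 1" using n by (simp add: n_def)
      ultimately show False using k by simp
    qed
  qed
  finally show ?thesis by (simp add: n_def)
qed

subsection \<open>Trees\<close>

lemma is_tree_prefix: "is_tree p \<Longrightarrow> t \<in> p \<Longrightarrow> prefix s t \<Longrightarrow> s \<in> p"
  unfolding is_tree_def by blast

lemma succs_mono: "p \<subseteq> T \<Longrightarrow> succs p t \<subseteq> succs T t"
  unfolding succs_def by blast

lemma succsD: "v \<in> succs p t \<Longrightarrow> v \<in> p \<and> prefix t v \<and> length v = Suc (length t)"
  unfolding succs_def by auto

text \<open>A proper initial segment of \<open>s\<close> has at most one successor, the next node on
  the way to \<open>s\<close>.\<close>

lemma branching_extends:
  assumes "\<And>v. v \<in> p \<Longrightarrow> prefix v s \<or> prefix s v" "t \<in> p" "card (succs p t) \<ge> 2"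
  shows "prefix s t"
proof (rule ccontr)
  assume "\<not> prefix s t"
  then have ts: "strict_prefix t s" using assms(1,2) by (auto simp: strict_prefix_def)
  then have len: "length t < length s" by (rule prefix_length_less)
  have "succs p t \<subseteq> {take (Suc (length t)) s}"
  proof
    fix v assume "v \<in> succs p t"
    then have v: "v \<in> p" "length v = Suc (length t)" using succsD by blast+
    then have "prefix v s"
      using assms(1)[of v] len by (metis Suc_leI prefix_length_le prefix_order.antisym
          prefix_length_prefix prefix_order.refl)
    then have "v = take (length v) s" by (auto simp: prefix_def)
    then show "v \<in> {take (Suc (length t)) s}" using v by simp
  qed
  then have "card (succs p t) \<le> card {take (Suc (length t)) s}" by (intro card_mono) auto
  then show False using assms(3) by simp
qed

text \<open>Two incomparable nodes split at a branching node that is shorter than \<open>s\<close>,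
  against the minimality of the stem.\<close>

lemma is_stem_comparable:
  assumes p: "is_tree p" "\<And>t. t \<in> p \<Longrightarrow> finite (succs p t)"
    and s: "is_stem p s" and t: "t \<in> p"
  shows "prefix t s \<or> prefix s t"
proof (rule ccontr)
  assume "\<not> ?thesis"
  then have "t \<parallel> s" by (auto intro: parallelI)
  then obtain as b bs c cs where *: "b \<noteq> c" "t = as @ b # bs" "s = as @ c # cs"
    using parallel_decomp by blast
  have sp: "s \<in> p" using s by (simp add: is_stem_def)
  have "prefix (as @ [b]) t" "prefix (as @ [c]) s" "prefix as s" using * by auto
  then have in_p: "as @ [b] \<in> p" "as @ [c] \<in> p" "as \<in> p"
    using is_tree_prefix[OF p(1)] t sp by blast+
  then have "{as @ [b], as @ [c]} \<subseteq> succs p as" unfolding succs_def by auto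
  then have "card {as @ [b], as @ [c]} \<le> card (succs p as)"
    using p(2)[OF in_p(3)] by (intro card_mono) auto
  then have "2 \<le> card (succs p as)" using * by simp
  then have "length s \<le> length as" using s in_p(3) by (auto simp: is_stem_def)
  then show False using * by simp
qed

lemma is_stem_stem:
  assumes p: "is_tree p" "\<And>t. t \<in> p \<Longrightarrow> finite (succs p t)" and ex: "\<exists>s. is_stem p s"
  shows "is_stem p (stem p)"
  unfolding stem_def
proof (rule theI')
  show "\<exists>!s. is_stem p s"
  proof (rule ex_ex1I[OF ex])
    fix s s' assume s: "is_stem p s" "is_stem p s'"
    then have "s \<in> p" "s' \<in> p" "length s \<le> length s'" "length s' \<le> length s"
      by (auto simp: is_stem_def)
    moreover have "prefix s s' \<or> prefix s' s"
      using is_stem_comparable[OF p s(2) \<open>s \<in> p\<close>] .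
    ultimately show "s = s'" by (auto simp: prefix_def)
  qed
qed

text \<open>The way in which all conditions are built here. Requiring \<open>G\<close> at every node
  between \<open>s\<close> and \<open>t\<close> makes the set closed under initial segments, while
  the successors above \<open>s\<close> are just the successors in \<open>T\<close> with
  \<open>G\<close>.\<close>

definition tree_from :: "node set \<Rightarrow> node \<Rightarrow> (node \<Rightarrow> bool) \<Rightarrow> node set" where
  "tree_from T s G = {t \<in> T. (prefix t s \<or> prefix s t) \<and>
     (\<forall>v. prefix s v \<longrightarrow> prefix v t \<longrightarrow> G v)}"

lemma tree_from_subset: "tree_from T s G \<subseteq> T"
  by (auto simp: tree_from_def)

lemma tree_from_comparable: "t \<in> tree_from T s G \<Longrightarrow> prefix t s \<or> prefix s t"
  by (simp add: tree_from_def)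

lemma tree_from_holds: "t \<in> tree_from T s G \<Longrightarrow> prefix s t \<Longrightarrow> G t"
  by (simp add: tree_from_def)

lemma root_in_tree_from: "s \<in> T \<Longrightarrow> G s \<Longrightarrow> s \<in> tree_from T s G"
  by (auto simp: tree_from_def dest: prefix_order.antisym)

lemma is_tree_tree_from:
  assumes "is_tree T" "s \<in> T" "G s"
  shows "is_tree (tree_from T s G)"
  unfolding is_tree_def
proof (intro conjI ballI allI impI)
  show "tree_from T s G \<noteq> {}" using root_in_tree_from[of s T G] assms by auto
  fix t u assume t: "t \<in> tree_from T s G" and u: "prefix u t"
  have "u \<in> T" using is_tree_prefix[OF assms(1) _ u] t by (auto simp: tree_from_def)
  moreover have "prefix u s \<or> prefix s u"
    using tree_from_comparable[OF t] u prefix_order.trans prefix_same_cases by blast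
  moreover have "\<forall>v. prefix s v \<longrightarrow> prefix v u \<longrightarrow> G v"
    using t u prefix_order.trans unfolding tree_from_def by blast
  ultimately show "u \<in> tree_from T s G" by (simp add: tree_from_def)
qed

lemma succs_tree_from:
  assumes "t \<in> tree_from T s G" "prefix s t"
  shows "succs (tree_from T s G) t = {v \<in> succs T t. G v}"
proof -
  have "t @ [n] \<in> tree_from T s G \<longleftrightarrow> t @ [n] \<in> T \<and> G (t @ [n])" for n
    using assms by (auto simp: tree_from_def)
  then show ?thesis unfolding succs_def by auto
qed

section \<open>Tree-creature frames and their conditions\<close>

locale creature_frame =
  fixes T :: "node set" and b :: "node \<Rightarrow> nat" and N :: "node \<Rightarrow> node set \<Rightarrow> ereal"
  assumes frame: "tree_creature_frame T b N"
begin

lemma is_tree_T: "is_tree T"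
  using frame by (simp add: tree_creature_frame_def)

lemma finite_succs_T: "t \<in> T \<Longrightarrow> finite (succs T t)"
  using frame by (simp add: tree_creature_frame_def)

lemma finite_succs: "p \<subseteq> T \<Longrightarrow> t \<in> p \<Longrightarrow> finite (succs p t)"
  using finite_subset[OF succs_mono finite_succs_T] by blast

lemma co_big_T: "t \<in> T \<Longrightarrow> co_big (b t) (succs T t) (N t)"
  using frame by (simp add: tree_creature_frame_def)

lemma norm_singleton: "t \<in> T \<Longrightarrow> v \<in> succs T t \<Longrightarrow> N t {v} < 1"
  using frame by (simp add: tree_creature_frame_def)

lemma norm_succs_T: "t \<in> T \<Longrightarrow> N t (succs T t) = \<infinity>"
  using frame by (simp add: tree_creature_frame_def)

lemma norm_empty: "t \<in> T \<Longrightarrow> N t {} = 0"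
  using co_big_T by (simp add: co_big_def set_norm_def)

lemma b_gt_one: "t \<in> T \<Longrightarrow> b t > 1"
  using co_big_T by (simp add: co_big_def)

lemma finite_Lev: "finite (Lev n T)"
proof (induction n)
  case 0
  have "Lev 0 T \<subseteq> {[]}" by (auto simp: Lev_def)
  then show ?case by (rule finite_subset) simp
next
  case (Suc n)
  have "Lev (Suc n) T \<subseteq> (\<Union>t\<in>Lev n T. succs T t)"
  proof
    fix t assume t: "t \<in> Lev (Suc n) T"
    then have "t \<in> T" "t \<noteq> []" "length t = Suc n" by (auto simp: Lev_def)
    moreover from this have "butlast t \<in> T"
      using is_tree_prefix[OF is_tree_T] prefixeq_butlast by blast
    ultimately have "butlast t \<in> Lev n T" "t \<in> succs T (butlast t)"
      by (auto simp: Lev_def succs_def intro: exI[of _ "last t"])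
    then show "t \<in> (\<Union>t\<in>Lev n T. succs T t)" by blast
  qed
  moreover have "finite (\<Union>t\<in>Lev n T. succs T t)"
    using Suc finite_succs_T by (auto simp: Lev_def)
  ultimately show ?case by (rule finite_subset)
qed

lemma eventually_b_ge: "\<exists>h. \<forall>t\<in>T. length t \<ge> h \<longrightarrow> b t \<ge> M"
proof -
  have "eventually (\<lambda>n. M \<le> Min (b ` Lev n T)) sequentially"
    using frame by (simp add: tree_creature_frame_def filterlim_at_top)
  then obtain h where h: "\<And>n. n \<ge> h \<Longrightarrow> M \<le> Min (b ` Lev n T)"
    unfolding eventually_sequentially by blast
  have "b t \<ge> M" if "t \<in> T" "length t \<ge> h" for t
  proof -
    have "t \<in> Lev (length t) T" using that by (simp add: Lev_def)
    then have "Min (b ` Lev (length t) T) \<le> b t" using finite_Lev by simp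
    then show ?thesis using h[OF that(2)] by simp
  qed
  then show ?thesis by blast
qed

text \<open>The empty set has norm \<open>0\<close> and singletons have norm below \<open>1\<close>.
  This turns norm bounds into branching.\<close>

lemma two_le_card:
  assumes "t \<in> T" "A \<subseteq> succs T t" "1 \<le> N t A"
  shows "card A \<ge> 2"
proof (rule ccontr)
  assume "\<not> ?thesis"
  then consider "card A = 0" | "card A = 1" by linarith
  then show False
  proof cases
    case 1
    then have "A = {}" using finite_subset[OF assms(2) finite_succs_T[OF assms(1)]] by simp
    then show False using assms norm_empty by simp
  next
    case 2
    then obtain v where "A = {v}" by (auto simp: card_1_singleton_iff)
    then show False using assms norm_singleton[of t v] by auto
  qed
qed

lemma EE_subset: "p \<in> EE T N \<Longrightarrow> p \<subseteq> T"
  by (simp add: EE_def)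

lemma EE_tree: "p \<in> EE T N \<Longrightarrow> is_tree p"
  by (simp add: EE_def)

lemma EE_is_stem:
  assumes "p \<in> EE T N"
  shows "is_stem p (stem p)"
  by (rule is_stem_stem) (use assms finite_succs in \<open>auto simp: EE_def\<close>)

lemma stem_in: "p \<in> EE T N \<Longrightarrow> stem p \<in> p"
  using EE_is_stem by (simp add: is_stem_def)

lemma EE_norm:
  assumes "p \<in> EE T N" "t \<in> p" "prefix (stem p) t"
  shows "1 + 1 / ereal (real (length (stem p))) \<le> N t (succs p t)"
  using assms by (simp add: EE_def)

lemma EE_norm_ge_one:
  assumes "p \<in> EE T N" "t \<in> p" "prefix (stem p) t"
  shows "1 \<le> N t (succs p t)"
proof -
  \<comment> \<open>This covers the empty stem, where the quotient is infinite.\<close>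
  have "0 \<le> 1 / ereal (real (length (stem p)))" by simp
  then have "1 + 0 \<le> 1 + 1 / ereal (real (length (stem p)))" by (rule add_left_mono)
  then show ?thesis using EE_norm[OF assms] by (metis add.right_neutral order.trans)
qed

lemma EE_extend:
  assumes "p \<in> EE T N"
  shows "\<exists>t\<in>p. prefix (stem p) t \<and> length t = length (stem p) + k"
proof (induction k)
  case 0
  then show ?case using stem_in[OF assms] by auto
next
  case (Suc k)
  then obtain t where t: "t \<in> p" "prefix (stem p) t" "length t = length (stem p) + k" by blast
  have "t \<in> T" using t EE_subset[OF assms] by blast
  then have "card (succs p t) \<ge> 2"
    using two_le_card[OF _ succs_mono EE_norm_ge_one[OF assms t(1,2)]] EE_subset[OF assms] by blast
  then obtain v where "v \<in> succs p t" by fastforce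
  then have "v \<in> p" "prefix t v" "length v = Suc (length t)" using succsD by blast+
  then show ?case using t prefix_order.trans by (intro bexI[of _ v]) auto
qed

text \<open>The norm bound at \<open>s\<close> forces branching there, and all nodes of the tree are
  comparable with \<open>s\<close>, so no shorter node branches.\<close>

lemma tree_from_EE:
  assumes s: "s \<in> T" "s \<noteq> []" "G s"
    and norm: "\<And>t. t \<in> T \<Longrightarrow> prefix s t \<Longrightarrow> G t \<Longrightarrow>
      ereal (1 + 1 / real (length s)) \<le> N t {v \<in> succs T t. G v}"
  shows "tree_from T s G \<in> EE T N" "stem (tree_from T s G) = s"
proof -
  let ?p = "tree_from T s G"
  have tree: "is_tree ?p" by (rule is_tree_tree_from[of T s G, OF is_tree_T s(1,3)])
  have sp: "s \<in> ?p" by (rule root_in_tree_from[of s T G, OF s(1,3)])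
  have n: "ereal (1 + 1 / real (length s)) \<le> N t (succs ?p t)" if "t \<in> ?p" "prefix s t" for t
    unfolding succs_tree_from[OF that]
    using norm[of t] that tree_from_subset tree_from_holds by blast
  have "1 \<le> ereal (1 + 1 / real (length s))" by (simp add: one_ereal_def)
  then have "1 \<le> N s (succs ?p s)" using n[OF sp prefix_order.refl] by (rule order.trans)
  then have "card (succs ?p s) \<ge> 2"
    by (intro two_le_card[OF s(1)] succs_mono[OF tree_from_subset])
  moreover have "length s \<le> length t" if "t \<in> ?p" "card (succs ?p t) \<ge> 2" for t
    by (rule prefix_length_le, rule branching_extends[OF tree_from_comparable that])
  ultimately have stem: "is_stem ?p s" using sp by (simp add: is_stem_def)
  have fin: "finite (succs ?p t)" if "t \<in> ?p" for t
    by (rule finite_succs[OF tree_from_subset that])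
  show st: "stem ?p = s"
    unfolding stem_def
  proof (rule the_equality[of "is_stem ?p", OF stem])
    fix s' assume s': "is_stem ?p s'"
    have "prefix s s'"
      by (rule branching_extends[OF tree_from_comparable]) (use s' in \<open>auto simp: is_stem_def\<close>)
    moreover have "length s' \<le> length s" using s' stem by (auto simp: is_stem_def)
    ultimately show "s' = s" by (auto simp: prefix_def)
  qed
  have "1 + 1 / ereal (real (length s)) = ereal (1 + 1 / real (length s))"
    using s(2) by (simp add: one_ereal_def)
  then show "?p \<in> EE T N"
    unfolding EE_def using tree tree_from_subset stem n st by auto
qed

text \<open>Above \<open>t0\<close> the successor sets of the finitely many trees are intersected,
  at the price given by \<open>co_big_Inter\<close>; below \<open>t0\<close> all the trees agree
  with its initial segments. The new stem \<open>t0\<close> fixes the norm that must remain.\<close>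

lemma Inter_EE:
  assumes t0: "t0 \<noteq> []" "\<And>p. p \<in> \<Q> \<Longrightarrow> t0 \<in> p"
    and Q: "finite \<Q>" "\<Q> \<noteq> {}" "\<And>p. p \<in> \<Q> \<Longrightarrow> p \<subseteq> T" "\<And>p. p \<in> \<Q> \<Longrightarrow> is_tree p"
    and norm: "\<And>p t. p \<in> \<Q> \<Longrightarrow> t \<in> p \<Longrightarrow> prefix t0 t \<Longrightarrow> ereal c \<le> N t (succs p t)"
    and c: "\<And>t. t \<in> T \<Longrightarrow> prefix t0 t \<Longrightarrow>
      1 + 1 / real (length t0) \<le> c - log (real (b t)) (real (card \<Q>) + 1)"
  shows "\<exists>q\<in>EE T N. \<forall>p\<in>\<Q>. q \<subseteq> p"
proof
  let ?G = "\<lambda>t. t \<in> \<Inter>\<Q>"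
  have t0T: "t0 \<in> T" using t0 Q by blast
  show "tree_from T t0 ?G \<in> EE T N"
  proof (rule tree_from_EE(1)[OF t0T t0(1)])
    fix t assume t: "t \<in> T" "prefix t0 t" "t \<in> \<Inter>\<Q>"
    have "ereal (1 + 1 / real (length t0)) \<le> ereal c - ereal (log (real (b t)) (real (card \<Q>) + 1))"
      using c[OF t(1,2)] by simp
    also have "\<dots> \<le> N t {v \<in> succs T t. \<forall>p\<in>\<Q>. v \<in> succs p t}"
      using t Q(3) norm
      by (intro co_big_Inter[OF co_big_T finite_succs_T norm_succs_T Q(1,2)] succs_mono) auto
    also have "{v \<in> succs T t. \<forall>p\<in>\<Q>. v \<in> succs p t} = {v \<in> succs T t. v \<in> \<Inter>\<Q>}"
      by (auto simp: succs_def)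
    finally show "ereal (1 + 1 / real (length t0)) \<le> N t {v \<in> succs T t. v \<in> \<Inter>\<Q>}" .
  qed (use t0 in auto)
  show "\<forall>p\<in>\<Q>. tree_from T t0 ?G \<subseteq> p"
  proof (intro ballI subsetI)
    fix p t assume p: "p \<in> \<Q>" and t: "t \<in> tree_from T t0 ?G"
    show "t \<in> p"
    proof (cases "prefix t0 t")
      case True
      then show ?thesis using tree_from_holds[OF t] p by blast
    next
      case False
      then have "prefix t t0" using tree_from_comparable[OF t] by blast
      then show ?thesis using is_tree_prefix[OF Q(4)[OF p] t0(2)[OF p]] by blast
    qed
  qed
qed

lemma EE'_D:
  assumes "p \<in> EE' T b N s" "s \<noteq> []"
  shows "p \<in> EE T N" "stem p = s" "p \<subseteq> T" "is_tree p" "s \<in> p"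
    "t \<in> p \<Longrightarrow> prefix s t \<Longrightarrow>
      ereal (1 + 1 / real (length s) + 4 * log (real (b t)) (real (length t))) \<le> N t (succs p t)"
  using assms EE_subset EE_tree stem_in[of p] by (auto simp: EE'_def)

text \<open>Cutting down by a factor \<open>1 - 1 / |t|\<^sup>2\<close> costs \<open>2 log |t|\<close> of the norm, half of what the
  conditions in \<open>EE'\<close> have in reserve.\<close>

lemma norm_average:
  assumes \<mu>: "fam W \<mu>" and r: "\<And>l. l \<in> W \<Longrightarrow> r l \<in> EE' T b N s"
    and s: "s \<noteq> []" and t: "t \<in> T" "prefix s t"
  shows "ereal (1 + 1 / real (length s)) \<le>
    N t {v \<in> succs T t. (1 - 1 / real (length t) ^ 2) * \<mu> {l \<in> W. t \<in> r l} \<le> \<mu> {l \<in> W. v \<in> r l}}"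
proof -
  let ?X = "{l \<in> W. t \<in> r l}" and ?m = "real (length t)" and ?L = "log (real (b t)) (real (length t))"
  have "t \<noteq> []" using s t by auto
  then have m: "?m \<ge> 1" by (simp add: Suc_leI)
  have L: "?L \<ge> 0" using m b_gt_one[OF t(1)] by (intro zero_le_log_cancel_iff[THEN iffD2]) auto
  have "log (real (b t)) (1 / (1 / ?m ^ 2)) = 2 * ?L"
    using m by (simp add: log_nat_power)
  then have "ereal (1 + 1 / real (length s)) \<le>
      ereal (1 + 1 / real (length s) + 4 * ?L) - ereal (log (real (b t)) (1 / (1 / ?m ^ 2)))"
    using L by simp
  also have "\<dots> \<le> N t {v \<in> succs T t. (1 - 1 / ?m ^ 2) * \<mu> ?X \<le> \<mu> {l \<in> ?X. v \<in> succs (r l) t}}"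
  proof (rule co_big_average[OF co_big_T finite_succs_T norm_succs_T \<mu>])
    show "succs (r l) t \<subseteq> succs T t" if "l \<in> ?X" for l
      using that EE'_D(3)[OF r s] by (intro succs_mono) auto
    show "ereal (1 + 1 / real (length s) + 4 * ?L) \<le> N t (succs (r l) t)" if "l \<in> ?X" for l
      using that EE'_D(6)[OF r s] t by auto
  qed (use t m in auto)
  also have "\<dots> \<le> N t {v \<in> succs T t. (1 - 1 / ?m ^ 2) * \<mu> ?X \<le> \<mu> {l \<in> W. v \<in> r l}}"
  proof (rule co_big_mono[OF co_big_T[OF t(1)]], safe)
    fix v assume v: "(1 - 1 / ?m ^ 2) * \<mu> ?X \<le> \<mu> {l \<in> ?X. v \<in> succs (r l) t}"
    also have "\<dots> \<le> \<mu> {l \<in> W. v \<in> r l}"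
      by (rule fam_mono[OF \<mu>]) (auto dest: succsD)
    finally show "(1 - 1 / ?m ^ 2) * \<mu> ?X \<le> \<mu> {l \<in> W. v \<in> r l}" .
  qed
  finally show ?thesis .
qed

end

subsection \<open>Limits of conditions\<close>

text \<open>The product of \<open>1 - 1 / k^2\<close> over \<open>n \<le> k < m\<close> equals
  \<open>decay m / decay n\<close> for \<open>n \<ge> 2\<close>. The values decrease to
  \<open>1\<close> from \<open>m = 2\<close> on; \<open>decay 1\<close> is \<open>0\<close> by
  division by zero.\<close>

definition decay :: "nat \<Rightarrow> real" where
  "decay m = real m / (real m - 1)"

text \<open>The factors \<open>1 - 1 / m\<^sup>2\<close> telescope. The case \<open>m = 1\<close> with its division by \<open>0\<close> only occurs
  together with \<open>c = 0\<close>.\<close>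

lemma decay_Suc:
  assumes "m \<ge> 2 \<or> c = 0"
  shows "(1 - 1 / real m ^ 2) * (c * decay m) = c * decay (Suc m)"
proof (cases "c = 0")
  case False
  then have m: "real m \<ge> 2" using assms by simp
  then have "1 - 1 / real m ^ 2 = (real m - 1) * (real m + 1) / real m ^ 2"
    by (simp add: field_simps power2_eq_square)
  then show ?thesis using m by (simp add: decay_def power2_eq_square)
qed simp

lemma decay_ge_one: "m \<ge> 2 \<Longrightarrow> decay m \<ge> 1"
  by (simp add: decay_def)

text \<open>An inequality, since for \<open>n = 1\<close> the left side is \<open>0\<close>; stems
  of length \<open>1\<close> lead to this case.\<close>

lemma decay_self: "n > 0 \<Longrightarrow> (1 - 1 / real n) * decay n \<le> 1"
  by (simp add: decay_def field_simps)

lemma decay_cancel: "n \<ge> 2 \<Longrightarrow> (1 - 1 / real n) * decay n = 1"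
  by (simp add: decay_def field_simps)

context creature_frame
begin

text \<open>The bound is cumulative: a node has to keep the measure above the product of all factors
  since \<open>s\<close>, whatever the loss at a single level.\<close>

definition lim_tree :: "'w set \<Rightarrow> ('w set \<Rightarrow> real) \<Rightarrow> node \<Rightarrow> ('w \<Rightarrow> node set) \<Rightarrow> node set" where
  "lim_tree W \<mu> s r = tree_from T s
     (\<lambda>t. (1 - 1 / real (length s)) * decay (length t) \<le> \<mu> {l \<in> W. t \<in> r l})"

text \<open>If \<open>t\<close> meets its threshold, then by telescoping so does every successor
  that loses at most the factor of \<open>norm_average\<close>. Both \<open>\<mu>\<close> and
  \<open>c\<close> are left open, for use with the limit measure and with a block average.\<close>

lemma norm_average_decay:
  assumes \<mu>: "fam W \<mu>" and r: "\<And>l. l \<in> W \<Longrightarrow> r l \<in> EE' T b N s"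
    and s: "s \<noteq> []" and t: "t \<in> T" "prefix s t"
    and c: "length t \<ge> 2 \<or> c = 0" "c * decay (length t) \<le> \<mu> {l \<in> W. t \<in> r l}"
  shows "ereal (1 + 1 / real (length s)) \<le>
    N t {v \<in> succs T t. c * decay (length v) \<le> \<mu> {l \<in> W. v \<in> r l}}"
proof -
  have "t \<noteq> []" using s t by auto
  then have "real (length t) \<ge> 1" by (simp add: Suc_leI)
  then have "1 - 1 / real (length t) ^ 2 \<ge> 0" using one_le_power[of "real (length t)" 2] by (simp add: divide_le_eq_1)
  then have "c * decay (Suc (length t)) \<le> (1 - 1 / real (length t) ^ 2) * \<mu> {l \<in> W. t \<in> r l}"
    unfolding decay_Suc[OF c(1), symmetric] by (rule mult_left_mono[OF c(2)])
  then have "N t {v \<in> succs T t. (1 - 1 / real (length t) ^ 2) * \<mu> {l \<in> W. t \<in> r l} \<le> \<mu> {l \<in> W. v \<in> r l}}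
      \<le> N t {v \<in> succs T t. c * decay (length v) \<le> \<mu> {l \<in> W. v \<in> r l}}"
    by (intro co_big_mono[OF co_big_T[OF t(1)]]) (auto dest: succsD)
  then show ?thesis using norm_average[OF \<mu> r s t] by (rule order.trans[rotated])
qed

text \<open>All conditions contain \<open>s\<close>, so the measure at the root is \<open>1\<close>,
  and \<open>norm_average_decay\<close> supplies the norm at every node above.\<close>

lemma lim_tree_EE:
  assumes \<mu>: "fam W \<mu>" and r: "\<And>l. l \<in> W \<Longrightarrow> r l \<in> EE' T b N s" and s: "s \<in> T" "s \<noteq> []"
  shows "lim_tree W \<mu> s r \<in> EE T N" "stem (lim_tree W \<mu> s r) = s"
proof -
  let ?c = "1 - 1 / real (length s)"
  have "{l \<in> W. s \<in> r l} = W" using EE'_D(5)[OF r s(2)] by auto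
  then have "?c * decay (length s) \<le> \<mu> {l \<in> W. s \<in> r l}"
    using decay_self[of "length s"] s \<mu> by (simp add: fam_def)
  moreover have "ereal (1 + 1 / real (length s)) \<le>
      N t {v \<in> succs T t. ?c * decay (length v) \<le> \<mu> {l \<in> W. v \<in> r l}}"
    if t: "t \<in> T" "prefix s t" and G: "?c * decay (length t) \<le> \<mu> {l \<in> W. t \<in> r l}" for t
  proof (rule norm_average_decay[OF \<mu> r s(2) t _ G])
    \<comment> \<open>Length \<open>1\<close> occurs only for \<open>t = s\<close>, and then the
      constant is \<open>0\<close>.\<close>
    have "length s \<le> length t" "length s > 0" using t s by (auto simp: prefix_length_le)
    then consider "length t \<ge> 2" | "length s = 1" by linarith
    then show "length t \<ge> 2 \<or> ?c = 0" by cases auto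
  qed
  ultimately show "lim_tree W \<mu> s r \<in> EE T N" "stem (lim_tree W \<mu> s r) = s"
    unfolding lim_tree_def using s by (intro tree_from_EE; blast)+
qed

text \<open>From level \<open>2\<close> on \<open>decay\<close> is at least \<open>1\<close>, so the
  threshold never falls below its limit \<open>1 - 1 / |s|\<close>.\<close>

lemma lim_tree_measure:
  assumes "t \<in> lim_tree W \<mu> s r" "prefix s t" "s \<noteq> []" "length t \<ge> 2"
  shows "1 - 1 / real (length s) \<le> \<mu> {l \<in> W. t \<in> r l}"
proof -
  have "1 - 1 / real (length s) \<ge> 0" using assms(3) by (simp add: Suc_leI divide_le_eq_1)
  then have "1 - 1 / real (length s) \<le> (1 - 1 / real (length s)) * decay (length t)"
    using decay_ge_one[OF assms(4)]
       mult_left_mono[of 1 "decay (length t)" "1 - 1 / real (length s)"] by simp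
  also have "\<dots> \<le> \<mu> {l \<in> W. t \<in> r l}"
    using assms tree_from_holds unfolding lim_tree_def by blast
  finally show ?thesis .
qed

section \<open>Amalgamating a condition with the members of the sequences\<close>

text \<open>At each level \<open>n\<close> sets of good successors and the successor set of
  \<open>q\<close> have norm at least \<open>1\<close>, and \<open>b\<close> is large enough for a
  common element. The whole path costs at most the factor \<open>1 - 1 / |t0|\<close>, whatever its
  length.\<close>

lemma EE_path:
  assumes q: "q \<in> EE T N" "t0 \<in> q" "prefix (stem q) t0" "length t0 \<ge> 2"
    and w: "fam W w"
    and s: "\<And>i. i < n \<Longrightarrow> s i \<noteq> [] \<and> prefix (s i) t0"
    and r: "\<And>i l. i < n \<Longrightarrow> l \<in> W \<Longrightarrow> r i l \<in> EE' T b N (s i)"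
    and b: "\<And>t. t \<in> T \<Longrightarrow> length t0 \<le> length t \<Longrightarrow> b t \<ge> n + 3"
  shows "\<exists>t\<in>q. prefix t0 t \<and> length t = length t0 + k \<and>
    (\<forall>i<n. w {l \<in> W. t0 \<in> r i l} * (1 - 1 / real (length t0)) * decay (length t) \<le> w {l \<in> W. t \<in> r i l})"
proof (induction k)
  case 0
  \<comment> \<open>The factor \<open>1 - 1 / |t0|\<close> cancels \<open>decay\<close> at
    \<open>t0\<close>, so the threshold starts at the weight of \<open>t0\<close> itself.\<close>
  show ?case
    by (intro bexI[OF _ q(2)]) (simp add: mult.assoc decay_cancel[OF q(4)])
next
  case (Suc k)
  let ?c = "\<lambda>i. w {l \<in> W. t0 \<in> r i l} * (1 - 1 / real (length t0))"
  obtain t where t: "t \<in> q" "prefix t0 t" "length t = length t0 + k"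
    and ct: "\<And>i. i < n \<Longrightarrow> ?c i * decay (length t) \<le> w {l \<in> W. t \<in> r i l}"
    using Suc by blast
  have tT: "t \<in> T" using t EE_subset[OF q(1)] by blast
  \<comment> \<open>Index \<open>n\<close> stands for \<open>q\<close>, which keeps the path inside
    \<open>q\<close>.\<close>
  define A where "A i = (if i < n then {v \<in> succs T t. ?c i * decay (length v) \<le> w {l \<in> W. v \<in> r i l}}
    else succs q t)" for i
  have A: "1 \<le> N t (A i)" for i
  proof (cases "i < n")
    case True
    have "1 \<le> ereal (1 + 1 / real (length (s i)))" by (simp add: one_ereal_def)
    also have "\<dots> \<le> N t (A i)"
      unfolding A_def using True s[OF True] t q(4) prefix_order.trans
      by (auto intro!: norm_average_decay[OF w r _ tT _ _ ct])
    finally show ?thesis .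
  next
    case False
    then show ?thesis
      unfolding A_def using EE_norm_ge_one[OF q(1) t(1)] q(3) t(2) prefix_order.trans by auto
  qed
  have "1 - ereal (log (real (b t)) (real (card {..n}) + 1))
      \<le> N t {v \<in> succs T t. \<forall>i\<in>{..n}. v \<in> A i}"
    by (rule co_big_Inter[OF co_big_T[OF tT] finite_succs_T[OF tT] norm_succs_T[OF tT]])
       (use A EE_subset[OF q(1)] succs_mono[of q T t] in \<open>auto simp: A_def split: if_splits\<close>)
  \<comment> \<open>The \<open>n + 1\<close> sets cost the logarithm of \<open>n + 2\<close>, which
    is below \<open>1\<close> because \<open>b t \<ge> n + 3\<close>.\<close>
  moreover have "log (real (b t)) (real (card {..n}) + 1) < 1"
    using b[OF tT] t(3) by (simp add: log_less_one_cancel_iff)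
  ultimately have "0 < N t {v \<in> succs T t. \<forall>i\<in>{..n}. v \<in> A i}"
    by (auto simp: one_ereal_def intro: less_le_trans[rotated])
  then have "{v \<in> succs T t. \<forall>i\<in>{..n}. v \<in> A i} \<noteq> {}" using norm_empty[OF tT] by force
  then obtain v where v: "\<And>i. i \<le> n \<Longrightarrow> v \<in> A i" by blast
  have vq: "v \<in> succs q t" using v[of n] by (simp add: A_def)
  show ?case
  proof (intro bexI[of _ v] conjI allI impI)
    show "prefix t0 v" "length v = length t0 + Suc k"
      using succsD[OF vq] t prefix_order.trans by auto
    show "v \<in> q" using succsD[OF vq] by blast
    fix i assume "i < n"
    then show "?c i * decay (length v) \<le> w {l \<in> W. v \<in> r i l}"
      using v[of i] by (simp add: A_def)
  qed
qed

text \<open>The height of \<open>t\<^sub>1\<close> depends on the number of conditions in the blocks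
  of \<open>u\<close>, so \<open>u\<close> must come first and can control the measure at
  \<open>t\<^sub>0\<close> only. From there on \<open>EE_path\<close> works with the block average
  in place of \<open>\<mu>\<close>.\<close>

lemma lim_tree_amalgamation:
  fixes n :: nat
  assumes \<Xi>: "fam K \<Xi>" and \<mu>: "fam W \<mu>"
    and lim: "block_limit K \<Xi> I \<mu>"
    and fbp: "finite_block_partition W K I"
    and s: "\<And>i. i < n \<Longrightarrow> s i \<in> T \<and> s i \<noteq> []"
    and r: "\<And>i l. i < n \<Longrightarrow> l \<in> W \<Longrightarrow> r i l \<in> EE' T b N (s i)"
    and P: "finite P" "P \<subseteq> Pow K" and \<epsilon>: "\<epsilon> > 0"
    and q: "q \<in> EE T N" and ql: "\<And>i. i < n \<Longrightarrow> q \<subseteq> lim_tree W \<mu> (s i) (r i)"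
  shows "\<exists>q'\<in>EE T N. \<exists>u. q' \<subseteq> q \<and> finite u \<and> u \<noteq> {} \<and> u \<subseteq> K \<and> approximates u P \<epsilon> \<Xi> \<and>
    (\<forall>i<n. (1 / real (card u)) *
      (\<Sum>k\<in>u. real (card {l \<in> I k. q' \<subseteq> r i l}) / real (card (I k)))
        > 1 - 2 / real (length (s i)) - \<epsilon>)"
\<comment> \<open>Without sequences \<open>q\<close> itself will do; with one, the stem of
  \<open>q\<close> extends some \<open>s i\<close> and so is nonempty.\<close>
proof (cases "n = 0")
  case True
  then show ?thesis using lim[unfolded block_limit_def, rule_format, OF P finite.emptyI \<epsilon>] q by blast
next
  case False
  note I = finite_block_partitionD[OF fbp]
  have stem_ext: "prefix (s i) (stem q)" if "i < n" for i
  proof (rule branching_extends)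
    show "prefix v (s i) \<or> prefix (s i) v" if "v \<in> q" for v
      using ql[OF \<open>i < n\<close>] that tree_from_comparable unfolding lim_tree_def by blast
  qed (use EE_is_stem[OF q] in \<open>auto simp: is_stem_def\<close>)
  define \<sigma> where "\<sigma> = length (stem q)"
  have "stem q \<noteq> []" using stem_ext[of 0] s[of 0] False by auto
  then have \<sigma>: "\<sigma> > 0" by (simp add: \<sigma>_def)
  obtain h\<^sub>0 where h\<^sub>0: "\<And>t. t \<in> T \<Longrightarrow> length t \<ge> h\<^sub>0 \<Longrightarrow> b t \<ge> n + 3"
    using eventually_b_ge by blast
  obtain h\<^sub>1 :: nat where h\<^sub>1: "2 / \<epsilon> < real h\<^sub>1" using reals_Archimedean2 by blast
  \<comment> \<open>\<open>h\<^sub>0\<close> provides for \<open>EE_path\<close>,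
    \<open>h\<^sub>1\<close> makes \<open>1 / |t\<^sub>0|\<close> less than
    \<open>\<epsilon> / 2\<close>, and \<open>2\<close> keeps \<open>decay\<close> at least
    \<open>1\<close>. The other \<open>\<epsilon> / 2\<close> is the precision of
    \<open>u\<close>.\<close>
  obtain t\<^sub>0 where t\<^sub>0: "t\<^sub>0 \<in> q" "prefix (stem q) t\<^sub>0" "length t\<^sub>0 = \<sigma> + (h\<^sub>0 + h\<^sub>1 + 2)"
    using EE_extend[OF q] unfolding \<sigma>_def by blast
  have "2 / \<epsilon> < real (length t\<^sub>0)" using h\<^sub>1 t\<^sub>0(3) by simp
  then have inv_t\<^sub>0: "1 / real (length t\<^sub>0) < \<epsilon> / 2" using \<epsilon> t\<^sub>0(3) by (simp add: field_simps)
  have s_t\<^sub>0: "prefix (s i) t\<^sub>0" if "i < n" for i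
    using stem_ext[OF that] t\<^sub>0(2) by (rule prefix_order.trans)
  obtain u where u: "finite u" "u \<noteq> {}" "u \<subseteq> K"
    and uP: "approximates u P (\<epsilon> / 2) \<Xi>"
    and uX: "\<And>i. i < n \<Longrightarrow>
      \<bar>block_avg I u {l \<in> W. t\<^sub>0 \<in> r i l} - \<mu> {l \<in> W. t\<^sub>0 \<in> r i l}\<bar> < \<epsilon> / 2"
    using lim[unfolded block_limit_def, rule_format, OF P,
        of "(\<lambda>i. {l \<in> W. t\<^sub>0 \<in> r i l}) ` {..<n}" "\<epsilon> / 2"] \<epsilon> by auto
  have uP': "approximates u P \<epsilon> \<Xi>" using uP \<epsilon> by (fastforce simp: approximates_def)
  let ?w = "block_avg I u"
  have w: "fam W ?w" using u I by (intro fam_block_avg) auto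
  define L where "L = (\<Union>k\<in>u. I k)"
  have L: "finite L" "L \<subseteq> W" using u I by (auto simp: L_def)
  define \<R> where "\<R> = insert q ((\<lambda>(i, l). r i l) ` ({..<n} \<times> L))"
  have fin\<R>: "finite \<R>" using L by (simp add: \<R>_def)
  \<comment> \<open>The exponent comes from \<open>1 / \<sigma> - 1 / (\<sigma> + 1) = 1 / (\<sigma>
    * (\<sigma> + 1))\<close>, a lower bound for the norm gained by a stem longer than
    \<open>\<sigma>\<close>. The logarithm of \<open>card \<R> + 1\<close> has to fit into this
    gap.\<close>
  obtain h\<^sub>2 where h\<^sub>2: "\<And>t. t \<in> T \<Longrightarrow> length t \<ge> h\<^sub>2 \<Longrightarrow> b t \<ge> (card \<R> + 1) ^ (\<sigma> * (\<sigma> + 1))"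
    using eventually_b_ge by blast
  have big: "b t \<ge> n + 3" if "t \<in> T" "length t\<^sub>0 \<le> length t" for t
    using h\<^sub>0[OF that(1)] that(2) t\<^sub>0(3) by simp
  have two: "2 \<le> length t\<^sub>0" using t\<^sub>0(3) by simp
  obtain t\<^sub>1 where t\<^sub>1: "t\<^sub>1 \<in> q" "prefix t\<^sub>0 t\<^sub>1" "length t\<^sub>1 = length t\<^sub>0 + h\<^sub>2"
    and wt\<^sub>1: "\<And>i. i < n \<Longrightarrow> ?w {l \<in> W. t\<^sub>0 \<in> r i l} * (1 - 1 / real (length t\<^sub>0)) * decay (length t\<^sub>1)
      \<le> ?w {l \<in> W. t\<^sub>1 \<in> r i l}"
    using EE_path[OF q t\<^sub>0(1,2) two w, of n s r h\<^sub>2] s s_t\<^sub>0 r big by blast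
  have weight: "1 - 1 / real (length (s i)) - \<epsilon> < ?w {l \<in> W. t\<^sub>1 \<in> r i l}" if i: "i < n" for i
  proof -
    let ?a = "?w {l \<in> W. t\<^sub>0 \<in> r i l}" and ?d = "1 / real (length t\<^sub>0)"
    have a: "0 \<le> ?a" "?a \<le> 1" using fam_nonneg[OF w] fam_le_one[OF w] by auto
    have d: "0 \<le> ?d" "?d \<le> 1" using two by (auto simp: divide_le_eq_1)
    have "1 - 1 / real (length (s i)) \<le> \<mu> {l \<in> W. t\<^sub>0 \<in> r i l}"
      using ql[OF i] t\<^sub>0(1) s[OF i] s_t\<^sub>0[OF i] two by (intro lim_tree_measure) auto
    then have "1 - 1 / real (length (s i)) - \<epsilon> / 2 < ?a" using uX[OF i] by linarith
    \<comment> \<open>As the weight is at most \<open>1\<close>, the factor \<open>1 - ?d\<close>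
      costs at most \<open>?d\<close>.\<close>
    moreover have "?a - ?d \<le> ?a * (1 - ?d)"
      using mult_right_mono[OF a(2) d(1)] by (simp add: algebra_simps)
    moreover have "?a * (1 - ?d) * 1 \<le> ?a * (1 - ?d) * decay (length t\<^sub>1)"
      using a d two t\<^sub>1(3) by (intro mult_left_mono decay_ge_one) auto
    ultimately show ?thesis using wt\<^sub>1[OF i] inv_t\<^sub>0 by linarith
  qed
  define \<Q> where "\<Q> = {p \<in> \<R>. t\<^sub>1 \<in> p}"
  have stem_t\<^sub>1: "prefix (stem q) t\<^sub>1" using t\<^sub>0(2) t\<^sub>1(2) by (rule prefix_order.trans)
  have \<Q>_cases: "p = q \<or> (\<exists>i l. i < n \<and> l \<in> W \<and> p = r i l)" if "p \<in> \<Q>" for p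
    using that L(2) by (auto simp: \<Q>_def \<R>_def)
  have card\<Q>: "card \<Q> \<le> card \<R>" unfolding \<Q>_def using fin\<R> by (intro card_mono) auto
  have "\<exists>q'\<in>EE T N. \<forall>p\<in>\<Q>. q' \<subseteq> p"
  \<comment> \<open>\<open>1 + 1 / \<sigma>\<close> is a common norm bound: it is that of
    \<open>q\<close>, and the stems \<open>s i\<close> are no longer than
    \<open>\<sigma>\<close>.\<close>
  proof (rule Inter_EE[of t\<^sub>1 \<Q> "1 + 1 / real \<sigma>"])
    show "t\<^sub>1 \<noteq> []" using t\<^sub>1(3) two by auto
    show "p \<subseteq> T" "is_tree p" if "p \<in> \<Q>" for p
      using \<Q>_cases[OF that] EE_subset[OF q] EE_tree[OF q] EE'_D(3,4)[OF r] s by blast+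
    show "ereal (1 + 1 / real \<sigma>) \<le> N t (succs p t)"
      if p: "p \<in> \<Q>" and t: "t \<in> p" "prefix t\<^sub>1 t" for p t
      using \<Q>_cases[OF p]
    proof (elim disjE exE conjE)
      assume "p = q"
      then show ?thesis
        using EE_norm[OF q, of t] t stem_t\<^sub>1 prefix_order.trans[of "stem q" t\<^sub>1 t] \<sigma>
        by (simp add: \<sigma>_def one_ereal_def)
    next
      fix i l assume i: "i < n" "l \<in> W" "p = r i l"
      have st: "prefix (s i) t"
        using stem_ext[OF i(1)] stem_t\<^sub>1 t(2) prefix_order.trans by blast
      have "p \<subseteq> T" using EE'_D(3)[OF r] i s by blast
      then have "b t > 1" using b_gt_one t by blast
      moreover have "t \<noteq> []" using t t\<^sub>1(3) two by auto
      ultimately have "0 \<le> log (real (b t)) (real (length t))"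
        by (intro zero_le_log_cancel_iff[THEN iffD2]) (auto simp: Suc_leI)
      moreover have "1 / real \<sigma> \<le> 1 / real (length (s i))"
        using prefix_length_le[OF stem_ext[OF i(1)]] s[OF i(1)] by (simp add: \<sigma>_def frac_le)
      ultimately have "ereal (1 + 1 / real \<sigma>) \<le>
          ereal (1 + 1 / real (length (s i)) + 4 * log (real (b t)) (real (length t)))" by simp
      also have "\<dots> \<le> N t (succs p t)"
        using EE'_D(6)[OF r[OF i(1,2)]] s[OF i(1)] t(1) st i(3) by blast
      finally show ?thesis .
    qed
    show "1 + 1 / real (length t\<^sub>1) \<le> 1 + 1 / real \<sigma> - log (real (b t)) (real (card \<Q>) + 1)"
      if t: "t \<in> T" "prefix t\<^sub>1 t" for t
    proof -
      have "length t \<ge> h\<^sub>2" using prefix_length_le[OF t(2)] t\<^sub>1(3) by simp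
      then have "(real (card \<R>) + 1) ^ (\<sigma> * (\<sigma> + 1)) \<le> real (b t)"
        using h\<^sub>2[OF t(1)] by (metis of_nat_1 of_nat_add of_nat_le_iff of_nat_power)
      then have "log (real (b t)) ((real (card \<R>) + 1) ^ (\<sigma> * (\<sigma> + 1))) \<le> 1"
        using b_gt_one[OF t(1)] by (subst log_le_one_cancel_iff) auto
      then have "real (\<sigma> * (\<sigma> + 1)) * log (real (b t)) (real (card \<R>) + 1) \<le> 1"
        by (subst (asm) log_nat_power) auto
      then have "log (real (b t)) (real (card \<R>) + 1) \<le> 1 / real (\<sigma> * (\<sigma> + 1))"
        using \<sigma> by (subst pos_le_divide_eq) (simp_all add: mult.commute del: of_nat_mult)
      also have "\<dots> = 1 / real \<sigma> - 1 / (real \<sigma> + 1)" using \<sigma> by (simp add: field_simps)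
      also have "\<dots> \<le> 1 / real \<sigma> - 1 / real (length t\<^sub>1)"
        using t\<^sub>1(3) t\<^sub>0(3) by (simp add: frac_le)
      finally have "log (real (b t)) (real (card \<R>) + 1) \<le> 1 / real \<sigma> - 1 / real (length t\<^sub>1)" .
      moreover have "log (real (b t)) (real (card \<Q>) + 1) \<le> log (real (b t)) (real (card \<R>) + 1)"
        using b_gt_one[OF t(1)] card\<Q> by (subst log_le_cancel_iff) auto
      ultimately show ?thesis by simp
    qed
  qed (use fin\<R> t\<^sub>1(1) in \<open>auto simp: \<Q>_def \<R>_def\<close>)
  then obtain q' where q': "q' \<in> EE T N" and sub: "\<And>p. p \<in> \<Q> \<Longrightarrow> q' \<subseteq> p" by blast
  have "1 - 2 / real (length (s i)) - \<epsilon> <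
      1 / real (card u) * (\<Sum>k\<in>u. real (card {l \<in> I k. q' \<subseteq> r i l}) / real (card (I k)))"
    if i: "i < n" for i
  proof -
    \<comment> \<open>Every condition from a block of \<open>u\<close> that passes through
      \<open>t\<^sub>1\<close> took part in the intersection, so \<open>q'\<close> lies below
      it.\<close>
    have "card (I k \<inter> {l \<in> W. t\<^sub>1 \<in> r i l}) \<le> card {l \<in> I k. q' \<subseteq> r i l}" if k: "k \<in> u" for k
    proof (intro card_mono subsetI)
      show "finite {l \<in> I k. q' \<subseteq> r i l}" using I k u by auto
      fix l assume l: "l \<in> I k \<inter> {l \<in> W. t\<^sub>1 \<in> r i l}"
      then have "r i l \<in> \<Q>" using i k by (auto simp: \<Q>_def \<R>_def L_def)
      then show "l \<in> {l \<in> I k. q' \<subseteq> r i l}" using sub l by blast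
    qed
    then have "?w {l \<in> W. t\<^sub>1 \<in> r i l} \<le>
        (\<Sum>k\<in>u. real (card {l \<in> I k. q' \<subseteq> r i l}) / real (card (I k))) / real (card u)"
      unfolding block_avg_def by (intro divide_right_mono sum_mono) auto
    \<comment> \<open>The argument loses only \<open>1 / |s i|\<close>, and the bound asked for is
      weaker.\<close>
    moreover have "1 / real (length (s i)) \<le> 2 / real (length (s i))"
      by (simp add: divide_right_mono)
    ultimately show ?thesis using weight[OF i] by simp
  qed
  moreover have "q' \<subseteq> q" using sub t\<^sub>1(1) by (auto simp: \<Q>_def \<R>_def)
  ultimately show ?thesis using q' u uP' by blast
qed

end

theorem theorem3p13:
  fixes T :: "node set"
    and b :: "node \<Rightarrow> nat"
    and N :: "node \<Rightarrow> node set \<Rightarrow> ereal"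
    and K :: "'k set"
    and \<Xi> :: "'k set \<Rightarrow> real"
    and W :: "'w set"
    and I :: "'k \<Rightarrow> 'w set"
  assumes "tree_creature_frame T b N"
    and "filterlim (\<lambda>n. Min ((\<lambda>t. log (real n) (real (b t))) ` Lev n T)) at_top sequentially"
    and "fam K \<Xi>"
    and "uap K \<Xi>"
    and "finite_block_partition W K I"
  shows "\<exists>Lim :: node \<Rightarrow> ('w \<Rightarrow> node set) \<Rightarrow> node set.
    (\<forall>s\<in>T - {[]}. Lim s \<in> (W \<rightarrow>\<^sub>E EE' T b N s) \<rightarrow> EE T N \<and>
       (\<forall>r \<in> W \<rightarrow>\<^sub>E EE' T b N s. stem (Lim s r) = s)) \<and>
    (\<forall>(n :: nat) (s :: nat \<Rightarrow> node) (r :: nat \<Rightarrow> 'w \<Rightarrow> node set) (P :: 'k set set) (\<epsilon> :: real).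
       \<forall>q\<in>EE T N.
         (\<forall>i<n. s i \<in> T - {[]} \<and> r i \<in> W \<rightarrow>\<^sub>E EE' T b N (s i)) \<longrightarrow>
         finite P \<longrightarrow> partition_on K P \<longrightarrow> \<epsilon> > 0 \<longrightarrow>
         (\<forall>i<n. q \<subseteq> Lim (s i) (r i)) \<longrightarrow>
         (\<exists>q'\<in>EE T N. \<exists>u. q' \<subseteq> q \<and> finite u \<and> u \<noteq> {} \<and> u \<subseteq> K \<and>
            approximates u P \<epsilon> \<Xi> \<and>
            (\<forall>i<n. (1 / real (card u)) *
                (\<Sum>k\<in>u. real (card {l \<in> I k. q' \<subseteq> r i l}) / real (card (I k)))
                  > 1 - 2 / real (length (s i)) - \<epsilon>)))"
proof -
  interpret creature_frame T b N by (rule creature_frame.intro[OF assms(1)])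
  obtain \<mu> where \<mu>: "fam W \<mu>"
    and lim: "block_limit K \<Xi> I \<mu>"
    using ex_limit_fam[OF assms(3-5)] by blast
  show ?thesis
  \<comment> \<open>\<open>\<mu>\<close> was chosen before any condition, so the same limit function
    serves all stems and all finite tuples of sequences.\<close>
  proof (intro exI[of _ "lim_tree W \<mu>"] conjI ballI allI impI Pi_I)
    fix s r assume s: "s \<in> T - {[]}" and r: "r \<in> W \<rightarrow>\<^sub>E EE' T b N s"
    have "r l \<in> EE' T b N s" if "l \<in> W" for l using r that by (rule PiE_mem)
    then show "lim_tree W \<mu> s r \<in> EE T N" "stem (lim_tree W \<mu> s r) = s"
      using lim_tree_EE[OF \<mu>, of r s] s by blast+
  next
    fix n :: nat and s :: "nat \<Rightarrow> node" and r P and \<epsilon> :: real and q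
    assume q: "q \<in> EE T N" and sr: "\<forall>i<n. s i \<in> T - {[]} \<and> r i \<in> W \<rightarrow>\<^sub>E EE' T b N (s i)"
      and P: "finite P" "partition_on K P" and \<epsilon>: "0 < \<epsilon>"
      and ql: "\<forall>i<n. q \<subseteq> lim_tree W \<mu> (s i) (r i)"
    have s: "s i \<in> T \<and> s i \<noteq> []" if "i < n" for i using sr that by blast
    have r: "r i l \<in> EE' T b N (s i)" if "i < n" "l \<in> W" for i l
      using sr that PiE_mem by blast
    have "P \<subseteq> Pow K" using P(2) by (auto simp: partition_on_def)
    then show "\<exists>q'\<in>EE T N. \<exists>u. q' \<subseteq> q \<and> finite u \<and> u \<noteq> {} \<and> u \<subseteq> K \<and> approximates u P \<epsilon> \<Xi> \<and>
        (\<forall>i<n. (1 / real (card u)) *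
          (\<Sum>k\<in>u. real (card {l \<in> I k. q' \<subseteq> r i l}) / real (card (I k)))
            > 1 - 2 / real (length (s i)) - \<epsilon>)"
      using ql by (intro lim_tree_amalgamation[OF assms(3) \<mu> lim assms(5) s r P(1) _ \<epsilon> q]) auto
  qed
qed

end
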